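(* Let $G=(V,E)$ be an undirected connected multi-graph on $n$ vertices and let $S\subseteq V$ be any Steiner set of $G$ with $|S|\ge 2$. Let $\lambda_S$ be the capacity of an $S$-mincut of $G$. There is a data structure occupying $\mathcal{O}(n(n-|S|+1))$ space that, given any pair of vertices $u,v$ of $G$, can determine in $\mathcal{O}(1)$ time whether the least capacity Steiner cut separating $u$ and $v$ has capacity $\lambda_S+1$. Moreover, the data structure can report a Steiner cut $C$ of capacity $\lambda_S+1$ separating $u$ and $v$ in $\mathcal{O}(n)$ time, if such a cut exists.
   Context: A cut is a set of vertices $C\subset V$ (nonempty, proper); $\overline{C}=V\setminus C$. A cut $C$ separates $u,v$ if exactly one of them lies in $C$. The capacity $c(C)$ is the number of edges (counted with multiplicity) with one endpoint in $C$ and the other in $\overline{C}$. A cut $C$ is a Steiner cut if there are $s_1,s_2\in S$ with $s_1\in C$, $s_2\notin C$. An $S$-mincut is a Steiner cut of minimum capacity, and $\lambda_S$ denotes that minimum capacity. Space is measured in machine words and time in the standard word-RAM model. *)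

theory Defs
  imports Complex_Main "HOL-Library.Multiset"
begin

section \<open>Multigraphs and Steiner cuts\<close>

text \<open>An undirected multigraph is a vertex set together with a multiset of edges, where an edge is
  the set of its endpoints. Loops (edges with a single endpoint) are permitted; they cross no cut.\<close>

definition multigraph :: "'a set \<Rightarrow> 'a set multiset \<Rightarrow> bool" where
  "multigraph V E \<longleftrightarrow> finite V \<and> (\<forall>e\<in>#E. \<exists>x\<in>V. \<exists>y\<in>V. e = {x, y})"

definition connected_multigraph :: "'a set \<Rightarrow> 'a set multiset \<Rightarrow> bool" where
  "connected_multigraph V E \<longleftrightarrow>
     multigraph V E \<and> V \<noteq> {} \<and> (\<forall>u\<in>V. \<forall>v\<in>V. (u, v) \<in> {(x, y). {x, y} \<in># E}\<^sup>*)"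

definition cut :: "'a set \<Rightarrow> 'a set \<Rightarrow> bool" where
  "cut V C \<longleftrightarrow> C \<noteq> {} \<and> C \<subset> V"

definition separates :: "'a set \<Rightarrow> 'a \<Rightarrow> 'a \<Rightarrow> bool" where
  "separates C u v \<longleftrightarrow> (u \<in> C) \<noteq> (v \<in> C)"

definition capacity :: "'a set \<Rightarrow> 'a set multiset \<Rightarrow> 'a set \<Rightarrow> nat" where
  "capacity V E C = size {#e \<in># E. \<exists>x\<in>C. \<exists>y\<in>V - C. e = {x, y}#}"

definition steiner_cut :: "'a set \<Rightarrow> 'a set \<Rightarrow> 'a set \<Rightarrow> bool" where
  "steiner_cut V S C \<longleftrightarrow> cut V C \<and> (\<exists>s1\<in>S. \<exists>s2\<in>S. s1 \<in> C \<and> s2 \<notin> C)"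

definition mincut_capacity :: "'a set \<Rightarrow> 'a set multiset \<Rightarrow> 'a set \<Rightarrow> nat" where
  "mincut_capacity V E S = Min (capacity V E ` {C. steiner_cut V S C})"

definition least_separating_steiner_cut ::
    "'a set \<Rightarrow> 'a set multiset \<Rightarrow> 'a set \<Rightarrow> 'a \<Rightarrow> 'a \<Rightarrow> 'a set \<Rightarrow> bool" where
  "least_separating_steiner_cut V E S u v C \<longleftrightarrow>
     is_arg_min (capacity V E) (\<lambda>C. steiner_cut V S C \<and> separates C u v) C"


section \<open>The word RAM\<close>

text \<open>Words of \<open>w\<close> bits are the natural numbers below \<open>2 ^ w\<close>. A program mentions finitely many
  registers; memory is addressed by words. Every instruction and every branch test takes one unit
  of time.\<close>

type_synonym reg = nat

datatype binop = Add | Sub | Mul | Div | Mod | And | Or | Xor | Shl | Shr | Less | Equal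

fun binop_val :: "nat \<Rightarrow> binop \<Rightarrow> nat \<Rightarrow> nat \<Rightarrow> nat" where
  "binop_val w Add x y = (x + y) mod 2 ^ w"
| "binop_val w Sub x y = nat ((int x - int y) mod 2 ^ w)"
| "binop_val w Mul x y = (x * y) mod 2 ^ w"
| "binop_val w Div x y = x div y"
| "binop_val w Mod x y = x mod y"
| "binop_val w And x y = and x y"
| "binop_val w Or x y = or x y"
| "binop_val w Xor x y = xor x y"
| "binop_val w Shl x y = (x * 2 ^ y) mod 2 ^ w"
| "binop_val w Shr x y = x div 2 ^ y"
| "binop_val w Less x y = of_bool (x < y)"
| "binop_val w Equal x y = of_bool (x = y)"

datatype prog =
    Skip
  | Const reg nat
  | Bin binop reg reg reg
  | Load reg reg
  | Store reg reg
  | Emit reg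
  | Seq prog prog
  | Cond reg prog prog
  | While reg prog

record ram =
  regs :: "reg \<Rightarrow> nat"
  mem :: "nat \<Rightarrow> nat"
  emitted :: "nat list"

text \<open>\<open>exec w P s t s'\<close>: started in \<open>s\<close> on a machine with word size \<open>w\<close>, the program \<open>P\<close> halts in \<open>s'\<close>
  after exactly \<open>t\<close> time units.\<close>

inductive exec :: "nat \<Rightarrow> prog \<Rightarrow> ram \<Rightarrow> nat \<Rightarrow> ram \<Rightarrow> bool" for w :: nat where
  Skip: "exec w Skip s 1 s"
| Const: "exec w (Const r k) s 1 (s\<lparr>regs := (regs s)(r := k mod 2 ^ w)\<rparr>)"
| Bin: "exec w (Bin f r a b) s 1 (s\<lparr>regs := (regs s)(r := binop_val w f (regs s a) (regs s b))\<rparr>)"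
| Load: "exec w (Load r a) s 1 (s\<lparr>regs := (regs s)(r := mem s (regs s a))\<rparr>)"
| Store: "exec w (Store a r) s 1 (s\<lparr>mem := (mem s)(regs s a := regs s r)\<rparr>)"
| Emit: "exec w (Emit r) s 1 (s\<lparr>emitted := emitted s @ [regs s r]\<rparr>)"
| Seq: "exec w P s t1 s' \<Longrightarrow> exec w Q s' t2 s'' \<Longrightarrow> exec w (Seq P Q) s (t1 + t2) s''"
| CondTrue: "regs s r \<noteq> 0 \<Longrightarrow> exec w P s t s' \<Longrightarrow> exec w (Cond r P Q) s (t + 1) s'"
| CondFalse: "regs s r = 0 \<Longrightarrow> exec w Q s t s' \<Longrightarrow> exec w (Cond r P Q) s (t + 1) s'"
| WhileFalse: "regs s r = 0 \<Longrightarrow> exec w (While r P) s 1 s"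
| WhileTrue: "regs s r \<noteq> 0 \<Longrightarrow> exec w P s t1 s' \<Longrightarrow> exec w (While r P) s' t2 s'' \<Longrightarrow>
    exec w (While r P) s (t1 + t2 + 1) s''"

inductive_cases exec_elims:
  "exec w Skip s t s'" "exec w (Const r k) s t s'" "exec w (Bin f r a b) s t s'"
  "exec w (Load r a) s t s'" "exec w (Store a r) s t s'" "exec w (Emit r) s t s'"
  "exec w (Seq P Q) s t s'" "exec w (Cond r P Q) s t s'" "exec w (While r P) s t s'"

lemma exec_deterministic:
  "exec w P s t s' \<Longrightarrow> exec w P s t' s'' \<Longrightarrow> t' = t \<and> s'' = s'"
proof (induction arbitrary: t' s'' rule: exec.induct)
  case (Seq P s t1 s1 Q t2 s2)
  show ?case by (rule exec_elims(7)[OF Seq.prems]) (metis Seq.IH)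
next
  case (CondTrue s r P t s1 Q)
  show ?case by (rule exec_elims(8)[OF CondTrue.prems]) (use CondTrue.hyps in \<open>simp_all add: CondTrue.IH\<close>)
next
  case (CondFalse s r Q t s1 P)
  show ?case by (rule exec_elims(8)[OF CondFalse.prems]) (use CondFalse.hyps in \<open>simp_all add: CondFalse.IH\<close>)
next
  case (WhileFalse s r P)
  show ?case by (rule exec_elims(9)[OF WhileFalse.prems]) (use WhileFalse.hyps in simp_all)
next
  case (WhileTrue s r P t1 s1 t2 s2)
  show ?case
  proof (rule exec_elims(9)[OF WhileTrue.prems])
    fix t3 s3 t4
    assume a: "t' = Suc (t3 + t4)" "exec w P s t3 s3" "exec w (While r P) s3 t4 s''"
    have "t3 = t1 \<and> s3 = s1" using WhileTrue.IH(1) a(2) by blast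
    with WhileTrue.IH(2)[of t4 s''] a show ?thesis by simp
  qed (use WhileTrue.hyps in simp_all)
qed (erule exec_elims, simp)+

text \<open>The data structure \<open>D\<close> occupies the first \<open>length D\<close> memory cells and the two query arguments
  are passed in registers \<open>0\<close> and \<open>1\<close>. All other registers and cells are working storage with
  arbitrary initial contents.\<close>

definition query_state :: "nat \<Rightarrow> nat list \<Rightarrow> nat \<Rightarrow> nat \<Rightarrow> ram \<Rightarrow> bool" where
  "query_state w D x y s \<longleftrightarrow>
     (\<forall>r. regs s r < 2 ^ w) \<and> (\<forall>a. mem s a < 2 ^ w) \<and> emitted s = [] \<and>
     regs s 0 = x \<and> regs s 1 = y \<and> (\<forall>i<length D. mem s i = D ! i)"

text \<open>The program \<open>P\<close> answers the query \<open>(x, y)\<close> on \<open>D\<close> within time \<open>T\<close> by emitting a list that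
  satisfies \<open>Q\<close>, and leaves \<open>D\<close> intact for subsequent queries.\<close>

definition answers_query ::
    "nat \<Rightarrow> prog \<Rightarrow> nat list \<Rightarrow> nat \<Rightarrow> nat \<Rightarrow> nat \<Rightarrow> (nat list \<Rightarrow> bool) \<Rightarrow> bool" where
  "answers_query w P D x y T Q \<longleftrightarrow>
     (\<forall>s. query_state w D x y s \<longrightarrow>
        (\<exists>t s'. exec w P s t s' \<and> t \<le> T \<and> Q (emitted s') \<and> (\<forall>i<length D. mem s' i = D ! i)))"

end

theory Submission
  imports Defs
begin

text \<open>Deciding needs only two labels per vertex: not being separated by any Steiner cut of capacity
  \<open>\<lambda>\<close> (or \<open>\<lambda> + 1\<close>) is an equivalence relation.

  For reporting, at most one cut per vertex is needed to separate every separable pair, and the cuts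
  contributed by the nonterminals can be stored in full within the space bound. What remains is to
  separate pairs of terminals by cuts whose traces on \<open>S\<close> take \<open>O(1)\<close> words. By the parity
  refinement \<open>c(A) + c(B) = c(A \<inter> B) + c(A \<union> B) + 2 d\<close> of submodularity, two crossing cuts of
  capacity \<open>\<lambda> + 1\<close> either have a diagonal of opposite corners of capacity \<open>\<lambda> + 1\<close>, and can be
  uncrossed, or have a corner of capacity \<open>\<lambda>\<close> on each diagonal, so that one of them is composite:
  up to complement a disjoint union of two minimum cuts. Hence a maximal cross-free family \<open>K\<close> of
  noncomposite cuts together with all composite cuts separates every separable pair of terminals.
  Composite cuts exist only for odd \<open>\<lambda>\<close>, and then, again by parity, minimum cuts cross neither each
  other nor noncomposite cuts. So one linear order of \<open>S\<close> turns the members of \<open>K\<close> and the minimum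
  cuts into intervals, up to complement, and composite cuts into symmetric differences of two
  intervals.\<close>

section \<open>Uncrossing Steiner cuts\<close>

lemma capacity_add_edge:
  "capacity V (add_mset e E) C = capacity V E C + of_bool (\<exists>x\<in>C. \<exists>y\<in>V - C. e = {x, y})"
  by (simp add: capacity_def)

lemma crossing_edge_iff:
  assumes "x \<in> V" "y \<in> V" "C \<subseteq> V"
  shows "(\<exists>a\<in>C. \<exists>b\<in>V - C. {x, y} = {a, b}) \<longleftrightarrow> (x \<in> C) \<noteq> (y \<in> C)"
  using assms by (auto simp: doubleton_eq_iff)

text \<open>Edge by edge, both sides agree except on edges joining \<open>A - B\<close> to
  \<open>B - A\<close>, which count twice on the left and never on the right. The witness
  \<open>d\<close> counts these edges; the form \<open>2 * d\<close> keeps submodularity and parity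
  at once.\<close>

lemma capacity_uncross:
  assumes "multigraph V E" "A \<subseteq> V" "B \<subseteq> V"
  obtains d where "capacity V E A + capacity V E B = capacity V E (A \<inter> B) + capacity V E (A \<union> B) + 2 * d"
proof -
  have "\<exists>d. capacity V E A + capacity V E B = capacity V E (A \<inter> B) + capacity V E (A \<union> B) + 2 * d"
    using assms(1)
  proof (induction E)
    case empty
    then show ?case by (simp add: capacity_def)
  next
    case (add e E)
    from add.prems obtain x y where xy: "x \<in> V" "y \<in> V" "e = {x, y}"
      by (auto simp: multigraph_def)
    from add obtain d where d: "capacity V E A + capacity V E B
        = capacity V E (A \<inter> B) + capacity V E (A \<union> B) + 2 * d"
      by (auto simp: multigraph_def)
    have sub: "A \<inter> B \<subseteq> V" "A \<union> B \<subseteq> V"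
      using assms by auto
    let ?d = "of_bool (x \<in> A - B \<and> y \<in> B - A \<or> x \<in> B - A \<and> y \<in> A - B) :: nat"
    have "capacity V (add_mset e E) A + capacity V (add_mset e E) B
        = capacity V (add_mset e E) (A \<inter> B) + capacity V (add_mset e E) (A \<union> B) + 2 * (d + ?d)"
      using d unfolding capacity_add_edge xy(3)
        crossing_edge_iff[OF xy(1,2) assms(2)] crossing_edge_iff[OF xy(1,2) assms(3)]
        crossing_edge_iff[OF xy(1,2) sub(1)] crossing_edge_iff[OF xy(1,2) sub(2)]
      by (cases "x \<in> A"; cases "x \<in> B"; cases "y \<in> A"; cases "y \<in> B") simp_all
    then show ?case by blast
  qed
  then show ?thesis using that by blast
qed

lemma capacity_complement:
  assumes "C \<subseteq> V"
  shows "capacity V E (V - C) = capacity V E C"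
proof -
  have "V - (V - C) = C" using assms by blast
  then have "(\<exists>x\<in>V - C. \<exists>y\<in>V - (V - C). e = {x, y}) \<longleftrightarrow> (\<exists>x\<in>C. \<exists>y\<in>V - C. e = {x, y})" for e
    by (metis insert_commute)
  then show ?thesis by (simp add: capacity_def)
qed

lemma capacity_empty [simp]: "capacity V E {} = 0"
  by (simp add: capacity_def)

section \<open>Laminar families as intervals of one numbering\<close>

text \<open>Splitting the ground set along a maximal proper member \<open>X\<close> leaves every other member on one
  side of \<open>X\<close>, so that orderings of the two sides can be concatenated.\<close>

lemma laminar_intervals:
  fixes L :: "'a set set"
  assumes "finite U" "\<And>X. X \<in> L \<Longrightarrow> X \<subseteq> U"
    "\<And>X Y. X \<in> L \<Longrightarrow> Y \<in> L \<Longrightarrow> X \<inter> Y = {} \<or> X \<subseteq> Y \<or> Y \<subseteq> X"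
  shows "\<exists>pos :: 'a \<Rightarrow> nat. (\<forall>x\<in>U. pos x < card U) \<and>
    (\<forall>X\<in>L. \<exists>l\<le>card U. \<exists>r\<le>card U. \<forall>x\<in>U. x \<in> X \<longleftrightarrow> l \<le> pos x \<and> pos x < r)"
  using assms
proof (induction "card U" arbitrary: U L rule: less_induct)
  case less
  show ?case
  proof (cases "\<exists>X\<in>L. X \<noteq> {} \<and> X \<noteq> U")
    case False
    then have triv: "X = {} \<or> X = U" if "X \<in> L" for X
      using that by blast
    have pos: "0 < card U" if "x \<in> U" for x
      using that less.prems(1) by (auto simp: card_gt_0_iff)
    \<comment> \<open>No member tells two elements apart here, so all may share position 0;
      \<open>pos\<close> need not be injective.\<close>
    moreover have "\<exists>l\<le>card U. \<exists>r\<le>card U. \<forall>x\<in>U. x \<in> X \<longleftrightarrow> l \<le> (0::nat) \<and> 0 < r" if "X \<in> L" for X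
      using triv[OF that] pos
      by (intro exI[of _ 0] conjI exI[of _ "if X = {} then 0 else card U"]) auto
    ultimately show ?thesis
      by (intro exI[of _ "\<lambda>_. 0"]) blast
  next
    case True
    \<comment> \<open>Excluding \<open>U\<close> makes \<open>X\<close> strictly smaller than
      \<open>U\<close>, and excluding the empty set does the same for \<open>U - X\<close>, so the
      induction applies to both sides.\<close>
    let ?P = "{X \<in> L. X \<noteq> {} \<and> X \<noteq> U}"
    have "finite ?P"
      by (rule finite_subset[of _ "Pow U"]) (use less.prems in auto)
    moreover have "?P \<noteq> {}" using True by blast
    ultimately obtain X where "X \<in> ?P" and Xmax': "\<forall>Y\<in>?P. X \<subseteq> Y \<longrightarrow> X = Y"
      by (rule finite_has_maximal[THEN bexE])
    then have X: "X \<in> L" "X \<noteq> {}" "X \<noteq> U" and Xmax: "\<And>Y. Y \<in> ?P \<Longrightarrow> X \<subseteq> Y \<Longrightarrow> X = Y"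
      by simp_all
    have XU: "X \<subset> U" using X less.prems(2) by blast
    have finX: "finite X" using XU less.prems(1) finite_subset by blast
    have card1: "card X < card U" using XU less.prems(1) by (rule psubset_card_mono[rotated])
    have card2: "card (U - X) < card U"
      using XU X(2) less.prems(1) by (intro psubset_card_mono) auto
    have card_sum: "card U = card X + card (U - X)"
      using XU less.prems(1) finX by (metis card_Diff_subset card_mono le_add_diff_inverse psubset_imp_subset)
    obtain p where p: "\<forall>x\<in>X. p x < card X"
      and p_iv: "\<forall>Y\<in>{Y \<in> L. Y \<subseteq> X}. \<exists>l\<le>card X. \<exists>r\<le>card X. \<forall>x\<in>X. x \<in> Y \<longleftrightarrow> l \<le> p x \<and> p x < r"
      using less.hyps[OF card1 finX, of "{Y \<in> L. Y \<subseteq> X}"] less.prems(3) by auto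
    obtain q where q: "\<forall>x\<in>U-X. q x < card (U - X)"
      and q_iv: "\<forall>Y\<in>{Y \<in> L. Y \<inter> X = {}}. \<exists>l\<le>card (U - X). \<exists>r\<le>card (U - X).
        \<forall>x\<in>U-X. x \<in> Y \<longleftrightarrow> l \<le> q x \<and> q x < r"
    proof -
      have "Y \<subseteq> U - X" if "Y \<in> {Y \<in> L. Y \<inter> X = {}}" for Y
        using that less.prems(2) by blast
      with less.hyps[OF card2, of "{Y \<in> L. Y \<inter> X = {}}"] less.prems(1,3) that show ?thesis
        by auto
    qed
    define pos where "pos = (\<lambda>x. if x \<in> X then p x else card X + q x)"
    have "\<forall>x\<in>U. pos x < card U"
      using p q card_sum by (auto simp: pos_def)
    moreover have "\<exists>l\<le>card U. \<exists>r\<le>card U. \<forall>x\<in>U. x \<in> Y \<longleftrightarrow> l \<le> pos x \<and> pos x < r" if Y: "Y \<in> L" for Y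
    proof -
      consider "Y = U" | "Y \<subseteq> X" | "Y \<inter> X = {}" "Y \<noteq> {}"
      proof (cases "Y = U \<or> Y \<subseteq> X")
        case False
        have "\<not> X \<subseteq> Y"
        proof
          assume XY: "X \<subseteq> Y"
          then have "Y \<in> ?P" using Y X(2) False by blast
          from Xmax[OF this XY] False show False by blast
        qed
        with less.prems(3)[OF Y X(1)] False have "Y \<inter> X = {}" "Y \<noteq> {}" by blast+
        then show ?thesis by (rule that(3))
      qed (use that in blast)
      then show ?thesis
      proof cases
        case 1
        then show ?thesis
          using \<open>\<forall>x\<in>U. pos x < card U\<close> by (intro exI[of _ 0] conjI exI[of _ "card U"]) simp_all
      next
        case 2
        then obtain l r where lr: "l \<le> card X" "r \<le> card X" "\<forall>x\<in>X. x \<in> Y \<longleftrightarrow> l \<le> p x \<and> p x < r"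
          using p_iv Y by blast
        then show ?thesis
          using 2 card_sum by (intro exI[of _ l] conjI exI[of _ r]) (auto simp: pos_def)
      next
        case 3
        then obtain l r where lr: "l \<le> card (U - X)" "r \<le> card (U - X)"
          "\<forall>x\<in>U-X. x \<in> Y \<longleftrightarrow> l \<le> q x \<and> q x < r"
          using q_iv Y by blast
        have "x \<in> Y \<longleftrightarrow> card X + l \<le> pos x \<and> pos x < card X + r" if "x \<in> U" for x
        proof (cases "x \<in> X")
          case True
          then have "x \<notin> Y" "pos x < card X" using 3 p by (auto simp: pos_def)
          then show ?thesis by simp
        next
          case False
          then show ?thesis using lr(3) that by (simp add: pos_def)
        qed
        then show ?thesis
          using lr(1,2) card_sum
          by (intro exI[of _ "card X + l"] conjI exI[of _ "card X + r"]) simp_all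
      qed
    qed
    ultimately show ?thesis by blast
  qed
qed

section \<open>Inseparability: the equivalence relation induced by a family of cuts\<close>

definition inseparable :: "'a set set \<Rightarrow> 'a \<Rightarrow> 'a \<Rightarrow> bool" where
  "inseparable F u v \<longleftrightarrow> (\<forall>C\<in>F. \<not> separates C u v)"

lemma inseparable_refl [simp]: "inseparable F u u"
  by (simp add: inseparable_def separates_def)

lemma inseparable_sym: "inseparable F u v \<longleftrightarrow> inseparable F v u"
  by (auto simp: inseparable_def separates_def)

lemma inseparable_trans: "inseparable F u v \<Longrightarrow> inseparable F v x \<Longrightarrow> inseparable F u x"
  by (auto simp: inseparable_def separates_def)

lemma inseparable_antimono: "G \<subseteq> F \<Longrightarrow> inseparable F u v \<Longrightarrow> inseparable G u v"
  by (auto simp: inseparable_def)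

text \<open>One cut per additional vertex suffices: a cut that separates the new vertex \<open>v\<close> from one
  vertex of its current class separates it from the whole class.\<close>

lemma separating_subfamily_extend:
  assumes "finite W" "G \<subseteq> F"
    and "\<And>u v. u \<in> X \<Longrightarrow> v \<in> X \<Longrightarrow> inseparable G u v \<Longrightarrow> inseparable F u v"
  shows "\<exists>H\<subseteq>F. finite H \<and> card H \<le> card W \<and>
    (\<forall>u\<in>X \<union> W. \<forall>v\<in>X \<union> W. inseparable (G \<union> H) u v \<longrightarrow> inseparable F u v)"
  using assms(1)
proof induction
  case empty
  then show ?case using assms(3) by (intro exI[of _ "{}"]) auto
next
  case (insert z W)
  then obtain H where H: "H \<subseteq> F" "finite H" "card H \<le> card W"
    and sep: "\<And>u v. u \<in> X \<union> W \<Longrightarrow> v \<in> X \<union> W \<Longrightarrow> inseparable (G \<union> H) u v \<Longrightarrow> inseparable F u v"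
    by blast
  let ?A = "X \<union> W"
  have GHF: "G \<union> H \<subseteq> F" using H(1) assms(2) by blast
  show ?case
  proof (cases "\<exists>x\<in>?A. inseparable (G \<union> H) z x \<and> \<not> inseparable F z x")
    case False
    have "inseparable F u v" if "u \<in> insert z ?A" "v \<in> insert z ?A" "inseparable (G \<union> H) u v" for u v
      using that sep False inseparable_sym inseparable_refl by (metis insertE)
    then show ?thesis
      using H insert.hyps by (intro exI[of _ H]) (simp add: le_SucI)
  next
    case True
    then obtain x C where x: "x \<in> ?A" "inseparable (G \<union> H) z x" and C: "C \<in> F" "separates C z x"
      unfolding inseparable_def by blast
    let ?H = "insert C H"
    have no_z: "\<not> inseparable (G \<union> ?H) z y" if y: "y \<in> ?A" for y
    proof
      assume zy: "inseparable (G \<union> ?H) z y"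
      then have "inseparable (G \<union> H) z y"
        using inseparable_antimono[of "G \<union> H" "G \<union> ?H"] by blast
      then have "inseparable (G \<union> H) x y"
        using x(2) inseparable_sym inseparable_trans by metis
      then have "inseparable F x y" using sep x(1) y by blast
      then have "\<not> separates C x y" using C(1) by (simp add: inseparable_def)
      moreover have "\<not> separates C z y" using zy by (simp add: inseparable_def)
      ultimately show False using C(2) by (auto simp: separates_def)
    qed
    have "inseparable F u v" if "u \<in> insert z ?A" "v \<in> insert z ?A" "inseparable (G \<union> ?H) u v" for u v
    proof -
      consider "u = z" "v = z" | "u \<in> ?A" "v \<in> ?A"
        using \<open>u \<in> insert z ?A\<close> \<open>v \<in> insert z ?A\<close> \<open>inseparable (G \<union> ?H) u v\<close>
          no_z inseparable_sym by (metis insertE)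
      then show ?thesis
        using sep inseparable_antimono[of "G \<union> H" "G \<union> ?H" u v] that(3) by cases auto
    qed
    moreover have "card ?H \<le> card (insert z W)"
      using H insert.hyps by (simp add: card_insert_if)
    ultimately show ?thesis
      using H C(1) by (intro exI[of _ ?H]) simp
  qed
qed

section \<open>Crossing Steiner cuts of capacity \<open>lam\<close> and
  \<open>lam + 1\<close>\<close>

locale steiner_multigraph =
  fixes V :: "'a set" and E :: "'a set multiset" and S :: "'a set"
  assumes multigraph: "multigraph V E" and S_subset: "S \<subseteq> V" and card_S: "2 \<le> card S"
begin

abbreviation cap :: "'a set \<Rightarrow> nat" where "cap \<equiv> capacity V E"

abbreviation lam :: nat where "lam \<equiv> mincut_capacity V E S"

definition cuts :: "nat \<Rightarrow> 'a set set" where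
  "cuts k = {C. steiner_cut V S C \<and> cap C = k}"

text \<open>Crossing is judged on terminals only: each of the four corners contains one, so all
  corners are Steiner cuts and have capacity at least \<open>lam\<close>.\<close>

definition crosses :: "'a set \<Rightarrow> 'a set \<Rightarrow> bool" where
  "crosses A B \<longleftrightarrow> S \<inter> A \<inter> B \<noteq> {} \<and> S \<inter> A - B \<noteq> {} \<and> S \<inter> B - A \<noteq> {} \<and> S - A - B \<noteq> {}"

definition composite :: "'a set \<Rightarrow> bool" where
  "composite A \<longleftrightarrow> (\<exists>M\<in>cuts lam. \<exists>N\<in>cuts lam. M \<inter> N = {} \<and> (M \<union> N = A \<or> M \<union> N = V - A))"

lemma finite_V: "finite V"
  using multigraph by (simp add: multigraph_def)

lemma steiner_cut_iff: "steiner_cut V S C \<longleftrightarrow> C \<subseteq> V \<and> S \<inter> C \<noteq> {} \<and> S - C \<noteq> {}"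
  using S_subset by (auto simp: steiner_cut_def cut_def)

lemma finite_steiner_cuts: "finite {C. steiner_cut V S C}"
  by (rule finite_subset[of _ "Pow V"]) (auto simp: steiner_cut_iff finite_V)

lemma finite_cuts: "finite (cuts k)"
  by (rule finite_subset[OF _ finite_steiner_cuts]) (auto simp: cuts_def)

lemma lam_le: "steiner_cut V S C \<Longrightarrow> lam \<le> cap C"
  unfolding mincut_capacity_def using finite_steiner_cuts by (intro Min_le) auto

lemma cuts_subset: "A \<in> cuts k \<Longrightarrow> A \<subseteq> V"
  by (simp add: cuts_def steiner_cut_iff)

lemma cuts_complement: "A \<in> cuts k \<Longrightarrow> V - A \<in> cuts k"
  using S_subset by (auto simp: cuts_def steiner_cut_iff capacity_complement)

lemma crosses_sym: "crosses A B \<longleftrightarrow> crosses B A"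
  by (auto simp: crosses_def)

lemma corners_steiner:
  assumes "crosses A B" "A \<subseteq> V" "B \<subseteq> V"
  shows "steiner_cut V S (A \<inter> B)" "steiner_cut V S (A \<union> B)"
    "steiner_cut V S (A - B)" "steiner_cut V S (B - A)"
  using assms unfolding crosses_def steiner_cut_iff by blast+

text \<open>The second identity is the first one for \<open>A\<close> and \<open>V - B\<close>,
  whose intersection is \<open>A - B\<close> and whose union is the complement of
  \<open>B - A\<close>.\<close>

lemma diagonals_uncross:
  assumes "A \<subseteq> V" "B \<subseteq> V"
  obtains d e where "cap A + cap B = cap (A \<inter> B) + cap (A \<union> B) + 2 * d"
    "cap A + cap B = cap (A - B) + cap (B - A) + 2 * e"
proof -
  obtain d where d: "cap A + cap B = cap (A \<inter> B) + cap (A \<union> B) + 2 * d"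
    using capacity_uncross[OF multigraph assms] .
  obtain e where e: "cap A + cap (V - B) = cap (A \<inter> (V - B)) + cap (A \<union> (V - B)) + 2 * e"
    using capacity_uncross[OF multigraph assms(1), of "V - B"] by blast
  have "A \<inter> (V - B) = A - B" "A \<union> (V - B) = V - (B - A)"
    using assms by blast+
  moreover have "cap (V - (B - A)) = cap (B - A)"
    using assms by (intro capacity_complement) blast
  ultimately have "cap A + cap B = cap (A - B) + cap (B - A) + 2 * e"
    using e capacity_complement[OF assms(2), of E] by simp
  with d that show ?thesis by blast
qed

text \<open>The empty intersection has capacity 0, so the union has capacity
  \<open>2 * lam - 2 * d\<close>. This is where the evenness of the defect is used.\<close>

lemma cap_disjoint_union_parity:
  assumes "A \<in> cuts lam" "B \<in> cuts lam" "A \<inter> B = {}"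
  shows "even (cap (A \<union> B))"
proof -
  obtain d where "cap A + cap B = cap (A \<inter> B) + cap (A \<union> B) + 2 * d"
    using capacity_uncross[OF multigraph] assms cuts_subset by metis
  then have "2 * lam = cap (A \<union> B) + 2 * d"
    using assms by (simp add: cuts_def)
  then show ?thesis by presburger
qed

text \<open>\<open>A\<close> has the capacity of a disjoint union of two minimum cuts, so
  \<open>lam + 1\<close> is even.\<close>

lemma composite_imp_odd:
  assumes "A \<in> cuts (lam + 1)" "composite A"
  shows "odd lam"
proof -
  obtain M N where MN: "M \<in> cuts lam" "N \<in> cuts lam" "M \<inter> N = {}" "M \<union> N = A \<or> M \<union> N = V - A"
    using assms(2) by (auto simp: composite_def)
  have "cap (M \<union> N) = lam + 1"
    using MN(4) assms(1) cuts_complement[OF assms(1)] by (auto simp: cuts_def)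
  then show ?thesis using cap_disjoint_union_parity[OF MN(1-3)] by simp
qed

text \<open>A corner from each diagonal: two such corners are adjacent, so their union is one of the two
  crossing cuts or its complement.\<close>

lemma min_corners:
  assumes "A \<subseteq> V" "B \<subseteq> V" "crosses A B"
    "cap (A \<inter> B) = lam \<or> cap (A \<union> B) = lam" "cap (A - B) = lam \<or> cap (B - A) = lam"
  shows "composite A \<or> composite B"
    and "cap A = lam \<or> cap A = lam + 1 \<Longrightarrow> cap B = lam \<Longrightarrow> odd lam \<Longrightarrow> composite A \<and> cap A = lam + 1"
proof -
  note st = corners_steiner[OF assms(3,1,2)]
  \<comment> \<open>\<open>P\<close> is a corner of capacity \<open>lam\<close> on the diagonal of
    \<open>A \<inter> B\<close> and the outer corner; \<open>Q\<close> is one on the other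
    diagonal.\<close>
  define P where "P = (if cap (A \<inter> B) = lam then A \<inter> B else V - (A \<union> B))"
  define Q where "Q = (if cap (A - B) = lam then A - B else B - A)"
  have P: "P \<in> cuts lam"
    using assms(4) st cuts_complement[of "A \<union> B" lam] by (auto simp: P_def cuts_def)
  have Q: "Q \<in> cuts lam"
    using assms(5) st by (auto simp: Q_def cuts_def)
  have PQ: "P \<inter> Q = {}"
    by (auto simp: P_def Q_def)
  have un: "P \<union> Q = A \<or> P \<union> Q = V - A \<or> P \<union> Q = B \<or> P \<union> Q = V - B"
    using assms(1,2) unfolding P_def Q_def
    by (cases "cap (A \<inter> B) = lam"; cases "cap (A - B) = lam"; simp; blast)
  then show "composite A \<or> composite B"
    using P Q PQ unfolding composite_def by blast
  \<comment> \<open>\<open>P \<union> Q\<close> has even capacity while \<open>lam\<close> is odd.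
    This rules out \<open>B\<close>, its complement and the case \<open>cap A = lam\<close>.\<close>
  assume *: "cap A = lam \<or> cap A = lam + 1" "cap B = lam" "odd lam"
  have ev: "even (cap (P \<union> Q))"
    using cap_disjoint_union_parity[OF P Q PQ] .
  have "cap (V - A) = cap A" "cap (V - B) = cap B"
    using assms(1,2) by (auto intro: capacity_complement)
  with un ev * have "(P \<union> Q = A \<or> P \<union> Q = V - A) \<and> cap A = lam + 1"
    by (metis)
  with P Q PQ show "composite A \<and> cap A = lam + 1"
    unfolding composite_def by blast
qed

text \<open>The two capacities add up to at most \<open>2 * lam + 1\<close> and every corner has at
  least \<open>lam\<close>, so each diagonal has a corner of capacity \<open>lam\<close>. For odd
  \<open>lam\<close> these corners would make \<open>A\<close> composite of capacity
  \<open>lam + 1\<close>.\<close>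

lemma crossing_mincut:
  assumes "odd lam" "A \<in> cuts lam \<or> A \<in> cuts (lam + 1) \<and> \<not> composite A" "B \<in> cuts lam"
  shows "\<not> crosses A B"
proof
  assume cr: "crosses A B"
  have sub: "A \<subseteq> V" "B \<subseteq> V" using assms cuts_subset by blast+
  obtain d e where de: "cap A + cap B = cap (A \<inter> B) + cap (A \<union> B) + 2 * d"
    "cap A + cap B = cap (A - B) + cap (B - A) + 2 * e"
    using diagonals_uncross[OF sub] .
  note le = corners_steiner[OF cr sub, THEN lam_le]
  have caps: "cap A = lam \<or> cap A = lam + 1" "cap B = lam"
    using assms by (auto simp: cuts_def)
  have "cap (A \<inter> B) = lam \<or> cap (A \<union> B) = lam" "cap (A - B) = lam \<or> cap (B - A) = lam"
    using de le caps by linarith+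
  from min_corners(2)[OF sub cr this caps assms(1)] assms(2) show False
    by (auto simp: cuts_def)
qed

text \<open>Corners of capacity \<open>lam\<close> on both diagonals would make \<open>A\<close> or
  \<open>B\<close> composite. On a diagonal without one, both corners have at least
  \<open>lam + 1\<close>, and submodularity allows no more.\<close>

lemma crossing_noncomposite:
  assumes "A \<in> cuts (lam + 1)" "B \<in> cuts (lam + 1)" "\<not> composite A" "\<not> composite B" "crosses A B"
  shows "A \<inter> B \<in> cuts (lam + 1) \<and> A \<union> B \<in> cuts (lam + 1) \<or>
    A - B \<in> cuts (lam + 1) \<and> B - A \<in> cuts (lam + 1)"
proof -
  have sub: "A \<subseteq> V" "B \<subseteq> V" using assms cuts_subset by blast+
  obtain d e where de: "cap A + cap B = cap (A \<inter> B) + cap (A \<union> B) + 2 * d"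
    "cap A + cap B = cap (A - B) + cap (B - A) + 2 * e"
    using diagonals_uncross[OF sub] .
  note st = corners_steiner[OF assms(5) sub]
  note le = st[THEN lam_le]
  have caps: "cap A = lam + 1" "cap B = lam + 1"
    using assms by (auto simp: cuts_def)
  have "\<not> (cap (A \<inter> B) = lam \<or> cap (A \<union> B) = lam) \<or> \<not> (cap (A - B) = lam \<or> cap (B - A) = lam)"
    using min_corners(1)[OF sub assms(5)] assms(3,4) by blast
  then have "cap (A \<inter> B) = lam + 1 \<and> cap (A \<union> B) = lam + 1 \<or>
      cap (A - B) = lam + 1 \<and> cap (B - A) = lam + 1"
    using de le caps by linarith
  then show ?thesis using st by (auto simp: cuts_def)
qed

section \<open>Uncrossing against a maximal cross-free family\<close>

lemma crosses_Compl:
  "crosses (- A) B \<longleftrightarrow> crosses A B" "crosses A (- B) \<longleftrightarrow> crosses A B"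
  unfolding crosses_def by blast+

text \<open>If \<open>A\<close> did not cross \<open>X\<close>, then within \<open>S\<close> either
  \<open>X\<close> or its complement would lie in \<open>A\<close>, and likewise for
  \<open>B\<close>. The same side twice puts it inside \<open>A \<inter> B\<close>, which then does
  not cross \<open>X\<close>; opposite sides make \<open>A\<close> and \<open>B\<close> cover
  \<open>S\<close>, so they do not cross.\<close>

lemma inter_crosses_fewer:
  assumes "crosses A B" "\<not> crosses X B" "crosses (A \<inter> B) X"
  shows "crosses A X"
proof (rule ccontr)
  assume "\<not> crosses A X"
  then have "S \<inter> X \<subseteq> A \<or> S - X \<subseteq> A"
    using assms(3) unfolding crosses_def by blast
  moreover have "S \<inter> X \<subseteq> B \<or> S - X \<subseteq> B"
    using assms(2,3) unfolding crosses_def by blast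
  ultimately show False
    using assms(1,3) unfolding crosses_def by blast
qed

text \<open>Up to complement, each corner is an intersection of \<open>A\<close> or
  \<open>- A\<close> with \<open>B\<close> or \<open>- B\<close>. With
  \<open>corner_not_crosses\<close>, passing from \<open>A\<close> to a corner loses the crossing
  with \<open>B\<close> and gains none within a cross-free family containing
  \<open>B\<close>.\<close>

lemma corner_crosses_fewer:
  assumes "crosses A B" "\<not> crosses X B" "Y \<in> {A \<inter> B, A \<union> B, A - B, B - A}" "crosses Y X"
  shows "crosses A X"
proof -
  have "A \<union> B = - (- A \<inter> - B)" "A - B = A \<inter> - B" "B - A = - A \<inter> B"
    by blast+
  then have "crosses (A \<inter> B) X \<or> crosses (- A \<inter> - B) X \<or> crosses (A \<inter> - B) X \<or> crosses (- A \<inter> B) X"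
    using assms(3,4) crosses_Compl(1) by (metis insertE empty_iff)
  then show ?thesis
    using assms(1,2) inter_crosses_fewer crosses_Compl by metis
qed

lemma corner_not_crosses:
  "Y \<in> {A \<inter> B, A \<union> B, A - B, B - A} \<Longrightarrow> \<not> crosses Y B"
  unfolding crosses_def by blast


lemma maximal_cross_free:
  obtains K where "K \<subseteq> {A \<in> cuts (lam + 1). \<not> composite A}" "\<forall>A\<in>K. \<forall>B\<in>K. \<not> crosses A B"
    "\<forall>A\<in>cuts (lam + 1). \<not> composite A \<longrightarrow> (\<forall>B\<in>K. \<not> crosses A B) \<longrightarrow> A \<in> K"
proof -
  let ?N = "{A \<in> cuts (lam + 1). \<not> composite A}"
  let ?F = "{K. K \<subseteq> ?N \<and> (\<forall>A\<in>K. \<forall>B\<in>K. \<not> crosses A B)}"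
  have "finite ?F"
    by (rule finite_subset[of _ "Pow ?N"]) (auto simp: finite_cuts)
  moreover have "{} \<in> ?F" by simp
  then have "?F \<noteq> {}" by blast
  ultimately obtain K where K: "K \<in> ?F" and max: "\<forall>K'\<in>?F. K \<subseteq> K' \<longrightarrow> K = K'"
    by (rule finite_has_maximal[THEN bexE])
  have "A \<in> K" if A: "A \<in> cuts (lam + 1)" "\<not> composite A" "\<forall>B\<in>K. \<not> crosses A B" for A
  proof -
    have "\<not> crosses A A" by (simp add: crosses_def)
    then have "insert A K \<in> ?F"
      using K A crosses_sym by auto
    from bspec[OF max this] have "K = insert A K" by (simp add: subset_insertI)
    then show ?thesis by blast
  qed
  with K show ?thesis by (intro that[of K]) auto
qed

text \<open>Induction on the number of members of \<open>K\<close> crossed by \<open>A\<close>. If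
  \<open>A\<close> is neither composite nor in \<open>K\<close>, maximality provides a crossing
  \<open>B\<close> in \<open>K\<close>. Unless \<open>B\<close> separates the pair, some corner on
  each diagonal does; one diagonal consists of cuts of capacity \<open>lam + 1\<close>, and these
  cross fewer members of \<open>K\<close>.\<close>

lemma separated_by_noncrossing_or_composite:
  assumes noncomp: "K \<subseteq> {A \<in> cuts (lam + 1). \<not> composite A}"
    and free: "\<forall>A\<in>K. \<forall>B\<in>K. \<not> crosses A B"
    and max: "\<forall>A\<in>cuts (lam + 1). \<not> composite A \<longrightarrow> (\<forall>B\<in>K. \<not> crosses A B) \<longrightarrow> A \<in> K"
    and "A \<in> cuts (lam + 1)" "separates A u v"
  shows "\<exists>B\<in>K \<union> {B \<in> cuts (lam + 1). composite B}. separates B u v"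
  using assms(4,5)
proof (induction "card {B \<in> K. crosses A B}" arbitrary: A rule: less_induct)
  case less
  have finK: "finite K"
    by (rule finite_subset[OF noncomp]) (simp add: finite_cuts)
  show ?case
  proof (cases "composite A \<or> A \<in> K")
    case True
    then show ?thesis using less.prems by blast
  next
    case False
    then obtain B where B: "B \<in> K" "crosses A B"
      using max less.prems(1) by blast
    have fewer: "card {X \<in> K. crosses Y X} < card {X \<in> K. crosses A X}"
      if Y: "Y \<in> {A \<inter> B, A \<union> B, A - B, B - A}" for Y
    proof (rule psubset_card_mono)
      show "{X \<in> K. crosses Y X} \<subset> {X \<in> K. crosses A X}"
        using corner_crosses_fewer[OF B(2) _ Y] corner_not_crosses[OF Y] free B by blast
    qed (use finK in simp)
    have corner: "\<exists>B\<in>K \<union> {B \<in> cuts (lam + 1). composite B}. separates B u v"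
      if "Y \<in> {A \<inter> B, A \<union> B, A - B, B - A}" "Y \<in> cuts (lam + 1)" "separates Y u v" for Y
      using less.hyps[OF fewer] that by blast
    have "A \<inter> B \<in> cuts (lam + 1) \<and> A \<union> B \<in> cuts (lam + 1) \<or>
        A - B \<in> cuts (lam + 1) \<and> B - A \<in> cuts (lam + 1)"
      using crossing_noncomposite[OF less.prems(1) _ _ _ B(2)] noncomp B(1) False by blast
    moreover have "separates (A \<inter> B) u v \<or> separates (A \<union> B) u v \<or> separates B u v"
      "separates (A - B) u v \<or> separates (B - A) u v \<or> separates B u v"
      using less.prems(2) unfolding separates_def by blast+
    ultimately show ?thesis
      using corner B(1) by blast
  qed
qed

section \<open>Threshold encoding of traces on the terminals\<close>

text \<open>Four thresholds encode the symmetric difference of two intervals.\<close>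

definition threshold_set :: "('a \<Rightarrow> nat) \<Rightarrow> 'a set \<Rightarrow> bool" where
  "threshold_set pos A \<longleftrightarrow> (\<exists>th :: nat \<Rightarrow> nat. (\<forall>j. th j \<le> card V) \<and>
     (\<forall>x\<in>S. x \<in> A \<longleftrightarrow> ((pos x < th 0) = (pos x < th 1)) \<noteq> ((pos x < th 2) = (pos x < th 3))))"

lemma threshold_setI:
  assumes "a \<le> card V" "b \<le> card V" "c \<le> card V" "d \<le> card V"
    "\<forall>x\<in>S. x \<in> A \<longleftrightarrow> ((pos x < a) = (pos x < b)) \<noteq> ((pos x < c) = (pos x < d))"
  shows "threshold_set pos A"
  unfolding threshold_set_def
  by (rule exI[of _ "\<lambda>j. if j = 0 then a else if j = 1 then b else if j = 2 then c else d"])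
    (use assms in simp)

lemma threshold_separators:
  obtains pos :: "'a \<Rightarrow> nat" where "\<forall>x\<in>S. pos x < card V"
    "\<And>A u v. A \<in> cuts (lam + 1) \<Longrightarrow> separates A u v \<Longrightarrow> u \<in> V \<Longrightarrow> v \<in> V \<Longrightarrow>
       \<exists>B\<in>cuts (lam + 1). threshold_set pos B \<and> separates B u v"
proof -
  have finS: "finite S" using S_subset finite_V finite_subset by blast
  have cardSV: "card S \<le> card V" using S_subset finite_V by (rule card_mono[rotated])
  obtain s0 where s0: "s0 \<in> S" using card_S by fastforce
  obtain K where K: "K \<subseteq> {A \<in> cuts (lam + 1). \<not> composite A}" and free: "\<forall>A\<in>K. \<forall>B\<in>K. \<not> crosses A B"
    and max: "\<forall>A\<in>cuts (lam + 1). \<not> composite A \<longrightarrow> (\<forall>B\<in>K. \<not> crosses A B) \<longrightarrow> A \<in> K"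
    by (rule maximal_cross_free)
  \<comment> \<open>Minimum cuts join only for odd \<open>lam\<close>: only then do composite cuts
    exist, and only then does \<open>crossing_mincut\<close> keep the family cross-free.\<close>
  define L where "L = K \<union> (if odd lam then cuts lam else {})"
  have mincut_free: "\<not> crosses A B" "\<not> crosses B A" if "odd lam" "A \<in> L" "B \<in> cuts lam" for A B
  proof -
    have "A \<in> cuts lam \<or> A \<in> cuts (lam + 1) \<and> \<not> composite A"
      using that K by (auto simp: L_def)
    from crossing_mincut[OF that(1) this that(3)] show "\<not> crosses A B" "\<not> crosses B A"
      by (simp_all add: crosses_sym)
  qed
  have Lfree: "\<not> crosses A B" if AB: "A \<in> L" "B \<in> L" for A B
  proof (cases "A \<in> K \<and> B \<in> K")
    case True
    then show ?thesis using free by blast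
  next
    case False
    then have "odd lam" "A \<in> cuts lam \<or> B \<in> cuts lam"
      using AB by (auto simp: L_def split: if_splits)
    then show ?thesis using mincut_free AB by blast
  qed
  \<comment> \<open>Taking the side without \<open>s0\<close> turns cross-free into laminar:
    \<open>s0\<close> lies outside both traces, so one of the other three corners is empty.\<close>
  define trace where "trace A = (if s0 \<in> A then S - A else S \<inter> A)" for A
  have lam_trace: "trace A \<inter> trace B = {} \<or> trace A \<subseteq> trace B \<or> trace B \<subseteq> trace A"
    if "A \<in> L" "B \<in> L" for A B
    using Lfree[OF that] s0 unfolding crosses_def trace_def by (auto split: if_splits)
  obtain pos where pos: "\<forall>x\<in>S. pos x < card S"
    and iv: "\<forall>X\<in>trace ` L. \<exists>l\<le>card S. \<exists>r\<le>card S. \<forall>x\<in>S. x \<in> X \<longleftrightarrow> l \<le> pos x \<and> pos x < r"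
  proof -
    have "X \<subseteq> S" if "X \<in> trace ` L" for X using that by (auto simp: trace_def)
    moreover have "X \<inter> Y = {} \<or> X \<subseteq> Y \<or> Y \<subseteq> X" if "X \<in> trace ` L" "Y \<in> trace ` L" for X Y
      using that lam_trace by auto
    ultimately have "\<exists>pos :: 'a \<Rightarrow> nat. (\<forall>x\<in>S. pos x < card S) \<and>
        (\<forall>X\<in>trace ` L. \<exists>l\<le>card S. \<exists>r\<le>card S. \<forall>x\<in>S. x \<in> X \<longleftrightarrow> l \<le> pos x \<and> pos x < r)"
      by (rule laminar_intervals[OF finS])
    then show ?thesis using that by (elim exE conjE)
  qed
  \<comment> \<open>\<open>f\<close> distinguishes an interval (true) from the complement of one
    (false).\<close>
  have flag: "\<exists>a b f. a \<le> card V \<and> b \<le> card V \<and> (\<forall>x\<in>S. x \<in> A \<longleftrightarrow> f \<noteq> ((pos x < a) = (pos x < b)))"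
    if A: "A \<in> L" for A
  proof -
    obtain l r where lr: "l \<le> card S" "r \<le> card S" "\<forall>x\<in>S. x \<in> trace A \<longleftrightarrow> l \<le> pos x \<and> pos x < r"
      using iv A by blast
    \<comment> \<open>For \<open>r < l\<close> the interval is empty, and \<open>min l r\<close>
      makes the two thresholds coincide.\<close>
    have "x \<in> A \<longleftrightarrow> (s0 \<notin> A) \<noteq> ((pos x < min l r) = (pos x < r))" if x: "x \<in> S" for x
    proof -
      have "x \<in> A \<longleftrightarrow> (s0 \<in> A) \<noteq> (x \<in> trace A)" using x by (simp add: trace_def)
      also have "x \<in> trace A \<longleftrightarrow> (pos x < min l r) \<noteq> (pos x < r)"
        using lr(3) x by (simp add: min_def) linarith
      finally show ?thesis by argo
    qed
    moreover have "min l r \<le> card V" "r \<le> card V" using lr cardSV by auto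
    ultimately show ?thesis
      by (rule_tac x = "min l r" in exI, rule_tac x = r in exI, rule_tac x = "s0 \<notin> A" in exI) simp
  qed
  have enc: "\<exists>a b c d f. a \<le> card V \<and> b \<le> card V \<and> c \<le> card V \<and> d \<le> card V \<and>
      (\<forall>x\<in>S. x \<in> A \<longleftrightarrow> f \<noteq> (((pos x < a) = (pos x < b)) \<noteq> ((pos x < c) = (pos x < d))))"
    if A: "A \<in> cuts (lam + 1)" "A \<in> K \<or> composite A" for A
  proof (cases "A \<in> K")
    case True
    then obtain a b f where "a \<le> card V" "b \<le> card V" "\<forall>x\<in>S. x \<in> A \<longleftrightarrow> f \<noteq> ((pos x < a) = (pos x < b))"
      using flag[of A] by (auto simp: L_def)
    \<comment> \<open>Two thresholds 0 make the second comparison constantly true, which negating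
      \<open>f\<close> compensates.\<close>
    then show ?thesis
      by (rule_tac x = a in exI, rule_tac x = b in exI, rule_tac x = 0 in exI,
          rule_tac x = 0 in exI, rule_tac x = "\<not> f" in exI) auto
  next
    case False
    then have comp: "composite A" using A by blast
    then obtain M N where MN: "M \<in> cuts lam" "N \<in> cuts lam" "M \<inter> N = {}" "M \<union> N = A \<or> M \<union> N = V - A"
      by (auto simp: composite_def)
    have in_L: "M \<in> L" "N \<in> L" using composite_imp_odd[OF A(1) comp] MN by (auto simp: L_def)
    obtain a b f where "a \<le> card V" "b \<le> card V" "\<forall>x\<in>S. x \<in> M \<longleftrightarrow> f \<noteq> ((pos x < a) = (pos x < b))"
      using flag[OF in_L(1)] by blast
    moreover obtain c d g where "c \<le> card V" "d \<le> card V" "\<forall>x\<in>S. x \<in> N \<longleftrightarrow> g \<noteq> ((pos x < c) = (pos x < d))"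
      using flag[OF in_L(2)] by blast
    moreover define h where "h \<longleftrightarrow> M \<union> N \<noteq> A"
    \<comment> \<open>As \<open>M\<close> and \<open>N\<close> are disjoint, membership in the union
      is an exclusive or; \<open>h\<close> records a complement.\<close>
    have "\<forall>x\<in>S. x \<in> A \<longleftrightarrow> (h \<noteq> ((x \<in> M) \<noteq> (x \<in> N)))"
      using MN(3,4) S_subset unfolding h_def by (cases "M \<union> N = A") auto
    ultimately show ?thesis
      by (rule_tac x = a in exI, rule_tac x = b in exI, rule_tac x = c in exI,
          rule_tac x = d in exI, rule_tac x = "h \<noteq> (f \<noteq> g)" in exI) auto
  qed
  \<comment> \<open>The sign \<open>f\<close> need not be stored: the complement is a cut of the
    same capacity that separates the same pairs of vertices.\<close>
  have thr: "threshold_set pos A \<or> threshold_set pos (V - A)"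
    if A: "A \<in> cuts (lam + 1)" "A \<in> K \<or> composite A" for A
  proof -
    obtain a b c d f where *: "a \<le> card V" "b \<le> card V" "c \<le> card V" "d \<le> card V"
      "\<forall>x\<in>S. x \<in> A \<longleftrightarrow> f \<noteq> (((pos x < a) = (pos x < b)) \<noteq> ((pos x < c) = (pos x < d)))"
      using enc[OF A] by blast
    show ?thesis
    proof (cases f)
      case False
      then show ?thesis
        using *(5) by (intro disjI1 threshold_setI[OF *(1-4)]) simp
    next
      case True
      have "\<forall>x\<in>S. x \<in> V - A \<longleftrightarrow> ((pos x < a) = (pos x < b)) \<noteq> ((pos x < c) = (pos x < d))"
        using *(5) True S_subset by blast
      then show ?thesis by (intro disjI2 threshold_setI[OF *(1-4)])
    qed
  qed
  show ?thesis
  proof (rule that[of pos])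
    fix A u v assume "A \<in> cuts (lam + 1)" "separates A u v" and uv: "u \<in> V" "v \<in> V"
    with separated_by_noncrossing_or_composite[OF K free max]
    obtain B where B: "B \<in> cuts (lam + 1)" "B \<in> K \<or> composite B" "separates B u v"
      using K by blast
    moreover have "separates (V - B) u v"
      using B(3) uv by (auto simp: separates_def)
    ultimately show "\<exists>B\<in>cuts (lam + 1). threshold_set pos B \<and> separates B u v"
      using thr[OF B(1,2)] cuts_complement[OF B(1)] by blast
  qed (use pos cardSV in auto)
qed

text \<open>The first part of the family consists of threshold sets, which need only the \<open>card (V - S)\<close>
  memberships of nonterminals to be spelled out; the second part is small enough to be stored in
  full.\<close>

lemma report_family:
  obtains pos :: "'a \<Rightarrow> nat" and Cs1 Cs2 where "\<forall>x\<in>S. pos x < card V"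
    "length Cs1 \<le> card S" "length Cs2 \<le> card (V - S)" "set Cs1 \<subseteq> cuts (lam + 1)" "set Cs2 \<subseteq> cuts (lam + 1)"
    "\<forall>C\<in>set Cs1. threshold_set pos C"
    "\<And>u v. u \<in> V \<Longrightarrow> v \<in> V \<Longrightarrow> (\<exists>C\<in>cuts (lam + 1). separates C u v) \<Longrightarrow> \<exists>C\<in>set (Cs1 @ Cs2). separates C u v"
proof -
  obtain pos :: "'a \<Rightarrow> nat" where pos: "\<forall>x\<in>S. pos x < card V"
    and sep: "\<And>A u v. A \<in> cuts (lam + 1) \<Longrightarrow> separates A u v \<Longrightarrow> u \<in> V \<Longrightarrow> v \<in> V \<Longrightarrow>
       \<exists>B\<in>cuts (lam + 1). threshold_set pos B \<and> separates B u v"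
    by (rule threshold_separators) blast
  have fin: "finite S" "finite (V - S)" using S_subset finite_V finite_subset by auto
  let ?T = "{C \<in> cuts (lam + 1). threshold_set pos C}"
  \<comment> \<open>One cut per terminal, drawn from the threshold cuts, which by \<open>sep\<close>
    separate as many pairs as all cuts of capacity \<open>lam + 1\<close>.\<close>
  obtain H where H: "H \<subseteq> ?T" "finite H" "card H \<le> card S"
    "\<forall>u\<in>S. \<forall>v\<in>S. inseparable H u v \<longrightarrow> inseparable ?T u v"
    using separating_subfamily_extend[OF fin(1), of "{}" ?T "{}"] by auto
  have "inseparable (cuts (lam + 1)) u v" if "u \<in> S" "v \<in> S" "inseparable H u v" for u v
  proof -
    have "inseparable ?T u v" using H(4) that by blast
    then show ?thesis
      using sep that(1,2) S_subset unfolding inseparable_def by blast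
  qed
  moreover have "H \<subseteq> cuts (lam + 1)" using H(1) by blast
  \<comment> \<open>One further cut per nonterminal extends the separation from \<open>S\<close> to
    \<open>V\<close>; these need not be threshold sets.\<close>
  ultimately obtain H' where H': "H' \<subseteq> cuts (lam + 1)" "finite H'" "card H' \<le> card (V - S)"
    "\<forall>u\<in>S \<union> (V - S). \<forall>v\<in>S \<union> (V - S). inseparable (H \<union> H') u v \<longrightarrow> inseparable (cuts (lam + 1)) u v"
    using separating_subfamily_extend[OF fin(2), of H "cuts (lam + 1)" S] by blast
  obtain Cs1 Cs2 where Cs: "set Cs1 = H" "distinct Cs1" "set Cs2 = H'" "distinct Cs2"
    using H(2) H'(2) finite_distinct_list by metis
  show ?thesis
  proof (rule that[of pos Cs1 Cs2])
    fix u v assume "u \<in> V" "v \<in> V" "\<exists>C\<in>cuts (lam + 1). separates C u v"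
    then show "\<exists>C\<in>set (Cs1 @ Cs2). separates C u v"
      using H'(4) Cs unfolding inseparable_def by auto
  qed (use pos Cs H H' distinct_card[of Cs1] distinct_card[of Cs2] in auto)
qed

text \<open>Steiner cuts have capacity at least \<open>lam\<close>, so only \<open>lam\<close> can
  undercut \<open>lam + 1\<close>. This reduces the decision to comparing two class labels.\<close>

lemma least_separating_iff:
  "(\<exists>C. least_separating_steiner_cut V E S u v C \<and> cap C = lam + 1) \<longleftrightarrow>
   inseparable (cuts lam) u v \<and> \<not> inseparable (cuts (lam + 1)) u v" (is "?L \<longleftrightarrow> ?R")
proof
  assume ?L
  then obtain C where C: "steiner_cut V S C" "separates C u v" "cap C = lam + 1"
    "\<And>D. steiner_cut V S D \<Longrightarrow> separates D u v \<Longrightarrow> \<not> cap D < cap C"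
    by (auto simp: least_separating_steiner_cut_def is_arg_min_def)
  then show ?R
    by (fastforce simp: inseparable_def cuts_def)
next
  assume R: ?R
  then obtain C where C: "steiner_cut V S C" "separates C u v" "cap C = lam + 1"
    by (auto simp: inseparable_def cuts_def)
  have "\<not> cap D < cap C" if "steiner_cut V S D" "separates D u v" for D
  proof -
    have "cap D \<noteq> lam" using R that by (auto simp: inseparable_def cuts_def)
    then show ?thesis using lam_le[OF that(1)] C(3) by linarith
  qed
  then show ?L using C by (auto simp: least_separating_steiner_cut_def is_arg_min_def)
qed

end

section \<open>The query programs\<close>

primrec loop_free :: "prog \<Rightarrow> bool" where
  "loop_free Skip \<longleftrightarrow> True"
| "loop_free (Const r k) \<longleftrightarrow> True"
| "loop_free (Bin f r a b) \<longleftrightarrow> True"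
| "loop_free (Load r a) \<longleftrightarrow> True"
| "loop_free (Store a r) \<longleftrightarrow> True"
| "loop_free (Emit r) \<longleftrightarrow> True"
| "loop_free (Seq P Q) \<longleftrightarrow> loop_free P \<and> loop_free Q"
| "loop_free (Cond r P Q) \<longleftrightarrow> loop_free P \<and> loop_free Q"
| "loop_free (While r P) \<longleftrightarrow> False"

primrec cost :: "prog \<Rightarrow> nat" where
  "cost Skip = 1"
| "cost (Const r k) = 1"
| "cost (Bin f r a b) = 1"
| "cost (Load r a) = 1"
| "cost (Store a r) = 1"
| "cost (Emit r) = 1"
| "cost (Seq P Q) = cost P + cost Q"
| "cost (Cond r P Q) = max (cost P) (cost Q) + 1"
| "cost (While r P) = 0"

text \<open>Meaningful only for loop-free programs; the values at loops are junk.\<close>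

primrec run :: "nat \<Rightarrow> prog \<Rightarrow> ram \<Rightarrow> ram" where
  "run w Skip s = s"
| "run w (Const r k) s = s\<lparr>regs := (regs s)(r := k mod 2 ^ w)\<rparr>"
| "run w (Bin f r a b) s = s\<lparr>regs := (regs s)(r := binop_val w f (regs s a) (regs s b))\<rparr>"
| "run w (Load r a) s = s\<lparr>regs := (regs s)(r := mem s (regs s a))\<rparr>"
| "run w (Store a r) s = s\<lparr>mem := (mem s)(regs s a := regs s r)\<rparr>"
| "run w (Emit r) s = s\<lparr>emitted := emitted s @ [regs s r]\<rparr>"
| "run w (Seq P Q) s = run w Q (run w P s)"
| "run w (Cond r P Q) s = (if regs s r \<noteq> 0 then run w P s else run w Q s)"
| "run w (While r P) s = s"

lemma exec_run: "loop_free P \<Longrightarrow> \<exists>t\<le>cost P. exec w P s t (run w P s)"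
proof (induction P arbitrary: s)
  case (Seq P Q)
  then obtain t1 t2 where "t1 \<le> cost P" "exec w P s t1 (run w P s)"
    "t2 \<le> cost Q" "exec w Q (run w P s) t2 (run w Q (run w P s))"
    by (metis loop_free.simps(7))
  then show ?case by (intro exI[of _ "t1 + t2"]) (auto intro: exec.Seq)
next
  case (Cond r P Q)
  then obtain t1 t2 where t: "t1 \<le> cost P" "exec w P s t1 (run w P s)"
    "t2 \<le> cost Q" "exec w Q s t2 (run w Q s)"
    by (metis loop_free.simps(8))
  show ?case
  proof (cases "regs s r = 0")
    case True
    then show ?thesis
      using t exec.CondFalse[OF True t(4), of P] by (intro exI[of _ "t2 + 1"]) auto
  next
    case False
    then show ?thesis
      using t exec.CondTrue[OF False t(2), of Q] by (intro exI[of _ "t1 + 1"]) auto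
  qed
qed (auto intro!: exI[of _ "Suc 0"] exec.intros(1-6)[unfolded One_nat_def])

text \<open>Each round pays for the body and one test; the final 1 is the failing test.\<close>

lemma exec_While_run:
  assumes "loop_free B" "\<And>i. i < k \<Longrightarrow> regs ((run w B ^^ i) s) r \<noteq> 0" "regs ((run w B ^^ k) s) r = 0"
  shows "\<exists>t\<le>k * (cost B + 1) + 1. exec w (While r B) s t ((run w B ^^ k) s)"
  using assms(2,3)
proof (induction k arbitrary: s)
  case 0
  then show ?case by (intro exI[of _ 1]) (simp add: exec.WhileFalse[unfolded One_nat_def])
next
  case (Suc k)
  obtain t1 where t1: "t1 \<le> cost B" "exec w B s t1 (run w B s)"
    using exec_run[OF assms(1)] by blast
  have "regs ((run w B ^^ i) (run w B s)) r \<noteq> 0" if "i < k" for i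
    using Suc.prems(1)[of "Suc i"] that by (simp add: funpow_swap1)
  moreover have "regs ((run w B ^^ k) (run w B s)) r = 0"
    using Suc.prems(2) by (simp add: funpow_swap1)
  ultimately obtain t2 where t2: "t2 \<le> k * (cost B + 1) + 1"
    "exec w (While r B) (run w B s) t2 ((run w B ^^ k) (run w B s))"
    using Suc.IH by blast
  have "regs s r \<noteq> 0" using Suc.prems(1)[of 0] by simp
  from exec.WhileTrue[OF this t1(2) t2(2)] show ?case
    using t1(1) t2(1) by (intro exI[of _ "t1 + t2 + 1"]) (simp add: funpow_swap1)
qed

primrec block :: "prog list \<Rightarrow> prog" where
  "block [] = Skip"
| "block (P # Ps) = Seq P (block Ps)"

section \<open>Testing a vertex against a stored cut\<close>

text \<open>The memory image: cell \<open>0\<close> holds \<open>n\<close>; the record of vertex \<open>x\<close> starts at \<open>8 * x + 8\<close> and holds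
  its column, its position and its class labels for the capacities \<open>\<lambda>\<close> and \<open>\<lambda> + 1\<close>; the record of cut \<open>i\<close> starts at
  \<open>8 * n + 8 * i + 8\<close> and holds the number of explicitly stored columns, a pointer to them, and four
  thresholds.\<close>

definition outside_flag :: "(nat \<Rightarrow> nat) \<Rightarrow> nat \<Rightarrow> nat \<Rightarrow> nat" where
  "outside_flag m x c =
     (if m (8 * x + 8) < m c then m (m (c + 1) + m (8 * x + 8))
      else of_bool (((m (8 * x + 9) < m (c + 2)) = (m (8 * x + 9) < m (c + 3))) =
        ((m (8 * x + 9) < m (c + 4)) = (m (8 * x + 9) < m (c + 5)))))"

text \<open>Register conventions: \<open>2\<close> and \<open>3\<close> hold the constants \<open>8\<close> and \<open>1\<close>, \<open>4\<close> holds \<open>n\<close>, \<open>5\<close> a cut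
  record, \<open>6\<close> a vertex, \<open>7\<close> the flag of that vertex, \<open>15\<close> the loop condition.\<close>

definition flag_prog :: prog where
  "flag_prog = block
    [Bin Mul 8 2 6, Bin Add 8 8 2, Load 9 8, Load 10 5, Bin Less 11 9 10, Bin Add 12 5 3,
     Cond 11
       (block [Load 10 12, Bin Add 10 10 9, Load 7 10])
       (block [Bin Add 8 8 3, Load 9 8,
         Bin Add 12 12 3, Load 10 12, Bin Less 10 9 10,
         Bin Add 12 12 3, Load 11 12, Bin Less 11 9 11, Bin Equal 10 10 11,
         Bin Add 12 12 3, Load 11 12, Bin Less 11 9 11,
         Bin Add 12 12 3, Load 13 12, Bin Less 13 9 13, Bin Equal 11 11 13,
         Bin Equal 7 10 11])]"

text \<open>The bounds prevent wraparound in address arithmetic; the conditional one serves the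
  branch that follows the pointer. The preserved registers are those in which the calling loops keep
  their state.\<close>

lemma run_flag_prog:
  assumes "regs s 2 = 8" "regs s 3 = 1" "8 * regs s 6 + 9 < 2 ^ w" "regs s 5 + 5 < 2 ^ w"
    "mem s (8 * regs s 6 + 8) < mem s (regs s 5) \<Longrightarrow>
      mem s (regs s 5 + 1) + mem s (8 * regs s 6 + 8) < 2 ^ w"
  shows "regs (run w flag_prog s) 7 = outside_flag (mem s) (regs s 6) (regs s 5)"
    "\<And>r. r < 7 \<or> 13 < r \<Longrightarrow> regs (run w flag_prog s) r = regs s r"
    "mem (run w flag_prog s) = mem s" "emitted (run w flag_prog s) = emitted s"
proof -
  define x c m W where "x = regs s 6" and "c = regs s 5" and "m = mem s" and "W = (2::nat) ^ w"
  note defs = x_def[symmetric] c_def[symmetric] m_def[symmetric] W_def[symmetric]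
  have b: "8 * x + 9 < W" "c + 5 < W" using assms(3,4) by (simp_all add: defs)
  have mods: "(8 * x) mod W = 8 * x" "(8 * x + 8) mod W = 8 * x + 8" "(8 * x + 8 + 1) mod W = 8 * x + 9"
    "(9 + 8 * x) mod W = 8 * x + 9" "(c + 1) mod W = c + 1" "(c + 1 + 1) mod W = c + 2"
    "(c + 2 + 1) mod W = c + 3" "(c + 3 + 1) mod W = c + 4" "(c + 4 + 1) mod W = c + 5"
    "(3 + c) mod W = c + 3" "(4 + c) mod W = c + 4" "(5 + c) mod W = c + 5"
    using b by simp_all
  have mod_ptr: "(m (c + 1) + m (8 * x + 8)) mod W = m (c + 1) + m (8 * x + 8)" if "m (8 * x + 8) < m c"
    using assms(5) that by (simp add: defs)
  have "regs (run w flag_prog s) 7 = outside_flag m x c \<and>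
    (\<forall>r. r < 7 \<or> 13 < r \<longrightarrow> regs (run w flag_prog s) r = regs s r) \<and>
    mem (run w flag_prog s) = mem s \<and> emitted (run w flag_prog s) = emitted s"
  proof (cases "m (8 * x + 8) < m c")
    case True
    then show ?thesis
      unfolding flag_prog_def outside_flag_def
      by (simp add: assms(1,2) defs mods mod_ptr del: One_nat_def add_Suc_right)
  next
    case False
    then show ?thesis
      unfolding flag_prog_def outside_flag_def
      by (simp add: assms(1,2) defs mods del: One_nat_def add_Suc_right add_2_eq_Suc')
  qed
  then show "regs (run w flag_prog s) 7 = outside_flag (mem s) (regs s 6) (regs s 5)"
    "\<And>r. r < 7 \<or> 13 < r \<Longrightarrow> regs (run w flag_prog s) r = regs s r"
    "mem (run w flag_prog s) = mem s" "emitted (run w flag_prog s) = emitted s"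
    by (auto simp: defs)
qed

section \<open>Searching for a separating cut and listing its vertices\<close>

definition cut_record :: "nat \<Rightarrow> nat \<Rightarrow> nat" where
  "cut_record n i = 8 * n + 8 * i + 8"

text \<open>Keeps addresses from overflowing. Which sets the records encode is left open;
  \<open>outside_flag\<close> reads them off the memory.\<close>

definition well_formed :: "nat \<Rightarrow> nat \<Rightarrow> nat \<Rightarrow> (nat \<Rightarrow> nat) \<Rightarrow> bool" where
  "well_formed w n M m \<longleftrightarrow> m 0 = n \<and> 8 * n + 8 * M + 16 < 2 ^ w \<and>
     (\<forall>x<n. \<forall>i<M. m (8 * x + 8) < m (cut_record n i) \<longrightarrow>
        m (cut_record n i + 1) + m (8 * x + 8) < 2 ^ w)"

text \<open>\<open>Or\<close> of a register with itself is a copy. The pointer moves before the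
  test, so register \<open>5\<close> starts one record early and on exit points at the cut found.
  The end of the table is not tested: a separating cut is presupposed.\<close>

definition scan_body :: prog where
  "scan_body = block [Bin Add 5 5 2, Bin Or 6 0 0, flag_prog, Bin Or 14 7 7, Bin Or 6 1 1, flag_prog,
     Bin Equal 15 14 7]"

definition emit_body :: prog where
  "emit_body = block [flag_prog, Cond 7 Skip (Emit 6), Bin Add 6 6 3, Bin Less 15 6 4]"

text \<open>Register \<open>4\<close> holds the address 0 before it receives the \<open>n\<close>
  stored there. The value \<open>8 * n\<close> in register \<open>5\<close> is one record before the
  first cut.\<close>

definition report_prog :: prog where
  "report_prog = block
     [block [Const 2 8, Const 3 1, Const 4 0, Load 4 4, Bin Mul 5 2 4, Const 15 1],
      While 15 scan_body, block [Const 6 0, Bin Less 15 6 4], While 15 emit_body]"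

lemma run_scan_body:
  assumes wf: "well_formed w n M (mem s)" and i: "i < M" and uv: "regs s 0 < n" "regs s 1 < n"
    and s: "regs s 2 = 8" "regs s 3 = 1" "regs s 5 = 8 * n + 8 * i"
  shows "regs (run w scan_body s) 15 =
      of_bool (outside_flag (mem s) (regs s 0) (cut_record n i) = outside_flag (mem s) (regs s 1) (cut_record n i))"
    "regs (run w scan_body s) 5 = cut_record n i" "\<And>r. r < 5 \<Longrightarrow> regs (run w scan_body s) r = regs s r"
    "mem (run w scan_body s) = mem s" "emitted (run w scan_body s) = emitted s"
proof -
  define m u v where "m = mem s" and "u = regs s 0" and "v = regs s 1"
  note defs = m_def[symmetric] u_def[symmetric] v_def[symmetric] v_def[unfolded One_nat_def, symmetric]
  have bound: "8 * n + 8 * M + 16 < 2 ^ w" using wf by (simp add: well_formed_def)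
  have ptr: "m (cut_record n i + 1) + m (8 * x + 8) < 2 ^ w"
    if "x < n" "m (8 * x + 8) < m (cut_record n i)" for x
    using wf i that by (simp add: well_formed_def m_def)
  define s1 where "s1 = run w (Bin Or 6 0 0) (run w (Bin Add 5 5 2) s)"
  have "regs s1 5 = (8 * n + 8 * i + 8) mod 2 ^ w" by (simp add: s1_def s)
  then have s1: "regs s1 5 = cut_record n i" "regs s1 6 = u" "mem s1 = m" "emitted s1 = emitted s"
    "\<And>r. r < 5 \<Longrightarrow> regs s1 r = regs s r"
    using bound i by (simp_all add: s1_def defs cut_record_def)
  have s1': "regs s1 2 = 8" "regs s1 3 = 1" "8 * regs s1 6 + 9 < 2 ^ w" "regs s1 5 + 5 < 2 ^ w"
    "mem s1 (8 * regs s1 6 + 8) < mem s1 (regs s1 5) \<Longrightarrow>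
      mem s1 (regs s1 5 + 1) + mem s1 (8 * regs s1 6 + 8) < 2 ^ w"
    using s uv bound i ptr[of u] s1(5)[of 2] s1(5)[of 3] by (simp_all add: s1(1-3) cut_record_def defs)
  define s2 where "s2 = run w (Bin Or 6 1 1) (run w (Bin Or 14 7 7) (run w flag_prog s1))"
  note f1 = run_flag_prog[OF s1']
  have s2: "regs s2 5 = cut_record n i" "regs s2 6 = v" "mem s2 = m" "emitted s2 = emitted s"
    "regs s2 14 = outside_flag m u (cut_record n i)" "\<And>r. r < 5 \<Longrightarrow> regs s2 r = regs s r"
    using f1 s1 by (simp_all add: s2_def defs)
  have s2': "regs s2 2 = 8" "regs s2 3 = 1" "8 * regs s2 6 + 9 < 2 ^ w" "regs s2 5 + 5 < 2 ^ w"
    "mem s2 (8 * regs s2 6 + 8) < mem s2 (regs s2 5) \<Longrightarrow>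
      mem s2 (regs s2 5 + 1) + mem s2 (8 * regs s2 6 + 8) < 2 ^ w"
    using s uv bound i ptr[of v] s2(6)[of 2] s2(6)[of 3] by (simp_all add: s2(1-3) cut_record_def defs)
  note f2 = run_flag_prog[OF s2']
  have eq: "run w scan_body s = run w (Bin Equal 15 14 7) (run w flag_prog s2)"
    by (simp add: scan_body_def s2_def s1_def)
  show "regs (run w scan_body s) 15 =
      of_bool (outside_flag (mem s) (regs s 0) (cut_record n i) = outside_flag (mem s) (regs s 1) (cut_record n i))"
    "regs (run w scan_body s) 5 = cut_record n i" "\<And>r. r < 5 \<Longrightarrow> regs (run w scan_body s) r = regs s r"
    "mem (run w scan_body s) = mem s" "emitted (run w scan_body s) = emitted s"
    unfolding eq using f2 s2 by (simp_all add: defs)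
qed

lemma run_emit_body:
  assumes wf: "well_formed w n M (mem s)" and i: "i < M" and x: "regs s 6 < n"
    and s: "regs s 2 = 8" "regs s 3 = 1" "regs s 4 = n" "regs s 5 = cut_record n i"
  shows "regs (run w emit_body s) 15 = of_bool (regs s 6 + 1 < n)" "regs (run w emit_body s) 6 = regs s 6 + 1"
    "\<And>r. r < 6 \<Longrightarrow> regs (run w emit_body s) r = regs s r" "mem (run w emit_body s) = mem s"
    "emitted (run w emit_body s) =
      emitted s @ (if outside_flag (mem s) (regs s 6) (cut_record n i) = 0 then [regs s 6] else [])"
proof -
  have bound: "8 * n + 8 * M + 16 < 2 ^ w" using wf by (simp add: well_formed_def)
  have ptr: "mem s (8 * regs s 6 + 8) < mem s (regs s 5) \<Longrightarrow>
      mem s (regs s 5 + 1) + mem s (8 * regs s 6 + 8) < 2 ^ w"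
    using wf i x s by (simp add: well_formed_def)
  have "8 * regs s 6 + 9 < 2 ^ w" "regs s 5 + 5 < 2 ^ w"
    using bound i x s by (simp_all add: cut_record_def)
  note f' = run_flag_prog[OF s(1,2) this ptr]
  have f: "regs (run w flag_prog s) 7 = outside_flag (mem s) (regs s 6) (cut_record n i)"
    "\<And>r. r < 7 \<or> 13 < r \<Longrightarrow> regs (run w flag_prog s) r = regs s r"
    "mem (run w flag_prog s) = mem s" "emitted (run w flag_prog s) = emitted s"
    using f' by (simp_all only: s(4))
  have "(regs s 6 + 1) mod 2 ^ w = regs s 6 + 1" using bound x by simp
  then show "regs (run w emit_body s) 15 = of_bool (regs s 6 + 1 < n)" "regs (run w emit_body s) 6 = regs s 6 + 1"
    "\<And>r. r < 6 \<Longrightarrow> regs (run w emit_body s) r = regs s r" "mem (run w emit_body s) = mem s"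
    "emitted (run w emit_body s) =
      emitted s @ (if outside_flag (mem s) (regs s 6) (cut_record n i) = 0 then [regs s 6] else [])"
    using s by (simp_all add: emit_body_def f)
qed

text \<open>The loop stops after \<open>k + 1\<close> rounds, where \<open>k\<close> is the least
  index of a separating cut.\<close>

lemma exec_scan_loop:
  assumes wf: "well_formed w n M (mem s)" and uv: "regs s 0 < n" "regs s 1 < n"
    and s: "regs s 2 = 8" "regs s 3 = 1" "regs s 5 = 8 * n" "regs s 15 = 1"
    and ex: "\<exists>i<M. outside_flag (mem s) (regs s 0) (cut_record n i) \<noteq> outside_flag (mem s) (regs s 1) (cut_record n i)"
  shows "\<exists>t s' i. exec w (While 15 scan_body) s t s' \<and> t \<le> M * (cost scan_body + 1) + 1 \<and> i < M \<and>
    outside_flag (mem s) (regs s 0) (cut_record n i) \<noteq> outside_flag (mem s) (regs s 1) (cut_record n i) \<and>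
    regs s' 5 = cut_record n i \<and> (\<forall>r<5. regs s' r = regs s r) \<and> mem s' = mem s \<and> emitted s' = emitted s"
proof -
  let ?sep = "\<lambda>i. outside_flag (mem s) (regs s 0) (cut_record n i) \<noteq> outside_flag (mem s) (regs s 1) (cut_record n i)"
  define k where "k = (LEAST i. ?sep i)"
  obtain i0 where i0: "i0 < M" "?sep i0" using ex by blast
  have sep_k: "?sep k" unfolding k_def using i0(2) by (rule LeastI)
  have kM: "k < M" using Least_le[of ?sep, OF i0(2)] i0(1) unfolding k_def by linarith
  have nsep: "\<not> ?sep i" if "i < k" for i using not_less_Least that unfolding k_def by blast
  let ?st = "\<lambda>i. (run w scan_body ^^ i) s"
  \<comment> \<open>After \<open>i\<close> rounds the cut tested last is \<open>i - 1\<close>; the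
    disjunct \<open>i = 0\<close> covers the initial value of register \<open>15\<close>.\<close>
  have inv: "regs (?st i) 5 = 8 * n + 8 * i \<and> (\<forall>r<5. regs (?st i) r = regs s r) \<and> mem (?st i) = mem s \<and>
    emitted (?st i) = emitted s \<and> regs (?st i) 15 = of_bool (i = 0 \<or> \<not> ?sep (i - 1))" if "i \<le> k + 1" for i
    using that
  proof (induction i)
    case 0
    then show ?case using s by simp
  next
    case (Suc i)
    then have IH: "regs (?st i) 5 = 8 * n + 8 * i" "\<And>r. r < 5 \<Longrightarrow> regs (?st i) r = regs s r"
      "mem (?st i) = mem s" "emitted (?st i) = emitted s"
      by auto
    define q where "q = ?st i"
    note IH = IH[folded q_def]
    have iM: "i < M" using Suc.prems kM by simp
    have wfq: "well_formed w n M (mem q)" using wf IH(3) by simp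
    have q: "regs q 0 = regs s 0" "regs q 1 = regs s 1" "regs q 2 = 8" "regs q 3 = 1"
      using IH(2) s by simp_all
    have uvq: "regs q 0 < n" "regs q 1 < n" using uv q by simp_all
    note b' = run_scan_body[OF wfq iM uvq q(3,4) IH(1)]
    have b: "regs (run w scan_body q) 15 = of_bool (\<not> ?sep i)"
      "regs (run w scan_body q) 5 = cut_record n i" "\<And>r. r < 5 \<Longrightarrow> regs (run w scan_body q) r = regs q r"
      "mem (run w scan_body q) = mem q" "emitted (run w scan_body q) = emitted q"
      using b' by (simp_all only: q(1,2) IH(3) not_not)
    have "?st (Suc i) = run w scan_body q" by (simp add: q_def)
    then show ?case
      using b IH(2-4) by (simp add: cut_record_def)
  qed
  have "regs (?st i) 15 \<noteq> 0" if "i < k + 1" for i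
    using inv[of i] nsep[of "i - 1"] that by (cases i) auto
  moreover have "regs (?st (k + 1)) 15 = 0"
    using inv[of "k + 1"] sep_k by simp
  moreover have "loop_free scan_body"
    by (simp add: scan_body_def flag_prog_def)
  ultimately obtain t where t: "t \<le> (k + 1) * (cost scan_body + 1) + 1"
    "exec w (While 15 scan_body) s t (?st (k + 1))"
    using exec_While_run by blast
  moreover have "(k + 1) * (cost scan_body + 1) \<le> M * (cost scan_body + 1)"
    using kM by (intro mult_le_mono1) simp
  ultimately have "t \<le> M * (cost scan_body + 1) + 1" by linarith
  moreover have "regs (?st (k + 1)) 5 = cut_record n k"
    using inv[of "k + 1"] by (simp add: cut_record_def)
  ultimately show ?thesis
    using t(2) kM sep_k inv[of "k + 1"] by blast
qed

lemma exec_emit_loop: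
  assumes wf: "well_formed w n M (mem s)" and i: "i < M" and n: "0 < n"
    and s: "regs s 2 = 8" "regs s 3 = 1" "regs s 4 = n" "regs s 5 = cut_record n i" "regs s 6 = 0" "regs s 15 = 1"
  shows "\<exists>t s'. exec w (While 15 emit_body) s t s' \<and> t \<le> n * (cost emit_body + 1) + 1 \<and> mem s' = mem s \<and>
    emitted s' = emitted s @ filter (\<lambda>x. outside_flag (mem s) x (cut_record n i) = 0) [0..<n]"
proof -
  let ?st = "\<lambda>k. (run w emit_body ^^ k) s"
  have inv: "(\<forall>r<6. regs (?st k) r = regs s r) \<and> regs (?st k) 6 = k \<and> mem (?st k) = mem s \<and>
    regs (?st k) 15 = of_bool (k < n) \<and>
    emitted (?st k) = emitted s @ filter (\<lambda>x. outside_flag (mem s) x (cut_record n i) = 0) [0..<k]" if "k \<le> n" for k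
    using that
  proof (induction k)
    case 0
    then show ?case using s n by simp
  next
    case (Suc k)
    then have IH: "\<And>r. r < 6 \<Longrightarrow> regs (?st k) r = regs s r" "regs (?st k) 6 = k" "mem (?st k) = mem s"
      "emitted (?st k) = emitted s @ filter (\<lambda>x. outside_flag (mem s) x (cut_record n i) = 0) [0..<k]"
      by auto
    define q where "q = ?st k"
    note IH = IH[folded q_def]
    have wfq: "well_formed w n M (mem q)" using wf IH(3) by simp
    have q: "regs q 2 = 8" "regs q 3 = 1" "regs q 4 = n" "regs q 5 = cut_record n i"
      using IH(1) s by simp_all
    have kq: "regs q 6 < n" using IH(2) Suc.prems by simp
    note b' = run_emit_body[OF wfq i kq q]
    have b: "regs (run w emit_body q) 15 = of_bool (k + 1 < n)" "regs (run w emit_body q) 6 = k + 1"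
      "\<And>r. r < 6 \<Longrightarrow> regs (run w emit_body q) r = regs q r" "mem (run w emit_body q) = mem q"
      "emitted (run w emit_body q) = emitted q @ (if outside_flag (mem q) k (cut_record n i) = 0 then [k] else [])"
      using b' by (simp_all only: IH(2))
    have "?st (Suc k) = run w emit_body q" by (simp add: q_def)
    then show ?case
      using b IH(1,3,4) by simp
  qed
  have "loop_free emit_body"
    by (simp add: emit_body_def flag_prog_def)
  moreover have "regs (?st k) 15 \<noteq> 0" if "k < n" for k using inv[of k] that by simp
  moreover have "regs (?st n) 15 = 0" using inv[of n] by simp
  ultimately obtain t where "t \<le> n * (cost emit_body + 1) + 1" "exec w (While 15 emit_body) s t (?st n)"
    using exec_While_run by blast
  then show ?thesis using inv[of n] by blast
qed

lemma exec_report_prog: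
  assumes wf: "well_formed w n M (mem s)" and uv: "regs s 0 < n" "regs s 1 < n" and M: "M \<le> n"
    and emp: "emitted s = []"
    and ex: "\<exists>i<M. outside_flag (mem s) (regs s 0) (cut_record n i) \<noteq> outside_flag (mem s) (regs s 1) (cut_record n i)"
  shows "\<exists>t s' i. exec w report_prog s t s' \<and> t \<le> 200 * n \<and> i < M \<and>
    outside_flag (mem s) (regs s 0) (cut_record n i) \<noteq> outside_flag (mem s) (regs s 1) (cut_record n i) \<and>
    mem s' = mem s \<and> emitted s' = filter (\<lambda>x. outside_flag (mem s) x (cut_record n i) = 0) [0..<n]"
proof -
  have bound: "8 * n + 8 * M + 16 < 2 ^ w" and m0: "mem s 0 = n" using wf by (simp_all add: well_formed_def)
  let ?init = "block [Const 2 8, Const 3 1, Const 4 0, Load 4 4, Bin Mul 5 2 4, Const 15 1]"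
  let ?mid = "block [Const 6 0, Bin Less 15 6 4]"
  define s1 where "s1 = run w ?init s"
  have w: "0 < w" using bound by (cases w) auto
  have mods: "8 mod 2 ^ w = (8::nat)" "1 mod 2 ^ w = (1::nat)" "Suc 0 mod 2 ^ w = Suc 0"
    "(8 * n) mod 2 ^ w = 8 * n"
    using bound w by simp_all
  have s1: "regs s1 0 = regs s 0" "regs s1 1 = regs s 1" "regs s1 2 = 8" "regs s1 3 = 1" "regs s1 4 = n"
    "regs s1 5 = 8 * n" "regs s1 15 = 1" "mem s1 = mem s" "emitted s1 = []"
    using w by (simp_all add: s1_def m0 emp mods)
  obtain t1 where t1: "t1 \<le> cost ?init" "exec w ?init s t1 s1"
    using exec_run[of ?init w s] unfolding s1_def by auto
  have pre: "well_formed w n M (mem s1)" "regs s1 0 < n" "regs s1 1 < n"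
    "\<exists>i<M. outside_flag (mem s1) (regs s1 0) (cut_record n i) \<noteq> outside_flag (mem s1) (regs s1 1) (cut_record n i)"
    unfolding s1 using wf uv ex .
  obtain t2 s2 i where t2: "exec w (While 15 scan_body) s1 t2 s2" "t2 \<le> M * (cost scan_body + 1) + 1" "i < M"
    "outside_flag (mem s1) (regs s1 0) (cut_record n i) \<noteq> outside_flag (mem s1) (regs s1 1) (cut_record n i)"
    and s2: "regs s2 5 = cut_record n i" "\<forall>r<5. regs s2 r = regs s1 r" "mem s2 = mem s1" "emitted s2 = emitted s1"
    using exec_scan_loop[OF pre(1-3) s1(3,4,6,7) pre(4)] by blast
  define s3 where "s3 = run w ?mid s2"
  have s3: "regs s3 2 = 8" "regs s3 3 = 1" "regs s3 4 = n" "regs s3 5 = cut_record n i" "regs s3 6 = 0"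
    "regs s3 15 = 1" "mem s3 = mem s" "emitted s3 = []"
    using s2 uv by (simp_all add: s3_def s1)
  obtain t3 where t3: "t3 \<le> cost ?mid" "exec w ?mid s2 t3 s3"
    using exec_run[of ?mid w s2] unfolding s3_def by auto
  have n: "0 < n" using uv by simp
  have wf3: "well_formed w n M (mem s3)" using wf s3(7) by simp
  obtain t4 s4 where t4: "exec w (While 15 emit_body) s3 t4 s4" "t4 \<le> n * (cost emit_body + 1) + 1"
    "mem s4 = mem s" "emitted s4 = filter (\<lambda>x. outside_flag (mem s) x (cut_record n i) = 0) [0..<n]"
    using exec_emit_loop[OF wf3 t2(3) n s3(1-6)] unfolding s3(7,8) append_Nil by blast
  \<comment> \<open>The last 1 is the \<open>Skip\<close> that closes the outer block.\<close>
  have "exec w report_prog s (t1 + (t2 + (t3 + (t4 + 1)))) s4"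
    unfolding report_prog_def block.simps(2)[of ?init] block.simps(2)[of "While 15 scan_body"]
      block.simps(2)[of ?mid] block.simps(2)[of "While 15 emit_body"] block.simps(1)
    by (intro exec.Seq[OF t1(2)] exec.Seq[OF t2(1)] exec.Seq[OF t3(2)] exec.Seq[OF t4(1)] exec.Skip)
  \<comment> \<open>The loops take at most \<open>101 * n + 1\<close> and \<open>51 * n + 1\<close>,
    the former by \<open>M \<le> n\<close>; the remaining constant is absorbed since
    \<open>1 \<le> n\<close>.\<close>
  moreover have "t1 + (t2 + (t3 + (t4 + 1))) \<le> 200 * n"
  proof -
    have "cost scan_body \<le> 100" "cost emit_body \<le> 50"
      by (simp_all add: scan_body_def emit_body_def flag_prog_def)
    then have "M * (cost scan_body + 1) \<le> n * 101" "n * (cost emit_body + 1) \<le> n * 51"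
      using M by (intro mult_le_mono; simp)+
    moreover have "cost ?init + cost ?mid \<le> 10" by simp
    moreover have "1 \<le> n" using uv by simp
    ultimately show ?thesis using t1(1) t2(2) t3(1) t4(2) by linarith
  qed
  ultimately show ?thesis
    using t2(3,4) t4(3,4) unfolding s1 by blast
qed

text \<open>Offsets 10 and 11 address the two class labels in a vertex record. The final
  \<open>Less\<close> on truth values yields 1 exactly when the labels for \<open>lam\<close> agree
  and those for \<open>lam + 1\<close> differ.\<close>

definition decide_prog :: prog where
  "decide_prog = block
    [Const 2 8, Const 3 1, Const 4 10, Bin Mul 0 2 0, Bin Mul 1 2 1, Bin Add 0 0 4, Bin Add 1 1 4,
     Load 5 0, Load 6 1, Bin Equal 5 5 6, Bin Add 0 0 3, Bin Add 1 1 3, Load 6 0, Load 7 1,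
     Bin Equal 6 6 7, Bin Less 5 6 5, Emit 5]"

lemma exec_decide_prog:
  assumes "regs s 0 = u" "regs s 1 = v" "8 * u + 16 < 2 ^ w" "8 * v + 16 < 2 ^ w" "emitted s = []"
  shows "\<exists>t s'. exec w decide_prog s t s' \<and> t \<le> 30 \<and> mem s' = mem s \<and>
    emitted s' = [of_bool (mem s (8 * u + 10) = mem s (8 * v + 10) \<and> mem s (8 * u + 11) \<noteq> mem s (8 * v + 11))]"
proof -
  define W where "W = (2::nat) ^ w"
  have w: "0 < w" using assms(3) by (cases w) auto
  have b: "8 * u + 16 < W" "8 * v + 16 < W" using assms by (simp_all add: W_def)
  have mods: "8 mod W = 8" "10 mod W = 10" "Suc 0 mod W = 1" "1 mod W = 1"
    "(8 * u) mod W = 8 * u" "(8 * v) mod W = 8 * v" "(8 * u + 10) mod W = 8 * u + 10"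
    "(8 * v + 10) mod W = 8 * v + 10" "(11 + 8 * u) mod W = 8 * u + 11" "(11 + 8 * v) mod W = 8 * v + 11"
    "(8 * u + 10 + 1) mod W = 8 * u + 11" "(8 * v + 10 + 1) mod W = 8 * v + 11"
    using b by simp_all
  have "mem (run w decide_prog s) = mem s" "emitted (run w decide_prog s) =
      [of_bool (mem s (8 * u + 10) = mem s (8 * v + 10) \<and> mem s (8 * u + 11) \<noteq> mem s (8 * v + 11))]"
    using assms(1,2,5) w by (simp_all add: decide_prog_def W_def[symmetric] mods del: One_nat_def add_Suc_right) blast
  moreover have "loop_free decide_prog" "cost decide_prog \<le> 30" by (simp_all add: decide_prog_def)
  ultimately show ?thesis using exec_run[of decide_prog w s] by (meson le_trans)
qed

section \<open>The memory image\<close>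

lemma concat_nth_offset:
  assumes "i < length xss" "j < length (xss ! i)"
  shows "sum_list (map length (take i xss)) + j < length (concat xss)"
    "concat xss ! (sum_list (map length (take i xss)) + j) = xss ! i ! j"
proof -
  have "sum_list (map length (take i xss)) + j < length (concat xss) \<and>
    concat xss ! (sum_list (map length (take i xss)) + j) = xss ! i ! j"
    using assms
  proof (induction xss arbitrary: i)
    case (Cons xs xss)
    then show ?case
      by (cases i) (auto simp: nth_append add.assoc)
  qed simp
  then show "sum_list (map length (take i xss)) + j < length (concat xss)"
    "concat xss ! (sum_list (map length (take i xss)) + j) = xss ! i ! j"
    by auto
qed

definition row_pointer :: "nat \<Rightarrow> nat list list \<Rightarrow> nat \<Rightarrow> nat" where
  "row_pointer n rows i = 8 * (n + length rows + 1) + sum_list (map length (take i rows))"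

text \<open>The content of address \<open>8 * q + r\<close>: block 0 is the header, the next
  \<open>n\<close> blocks are vertex records and the rest are cut records. Surplus cells of a block
  hold arbitrary values.\<close>

definition cell :: "nat \<Rightarrow> (nat \<Rightarrow> nat \<Rightarrow> nat) \<Rightarrow> (nat \<Rightarrow> nat \<Rightarrow> nat) \<Rightarrow> nat list list \<Rightarrow> nat \<Rightarrow> nat \<Rightarrow> nat" where
  "cell n vrec thr rows q r =
     (if q = 0 then n
      else if q \<le> n then vrec (q - 1) r
      else if r = 0 then length (rows ! (q - 1 - n))
      else if r = 1 then row_pointer n rows (q - 1 - n)
      else thr (q - 1 - n) (r - 2))"

definition layout :: "nat \<Rightarrow> (nat \<Rightarrow> nat \<Rightarrow> nat) \<Rightarrow> (nat \<Rightarrow> nat \<Rightarrow> nat) \<Rightarrow> nat list list \<Rightarrow> nat list" where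
  "layout n vrec thr rows =
     map (\<lambda>a. cell n vrec thr rows (a div 8) (a mod 8)) [0..<8 * (n + length rows + 1)] @ concat rows"

lemma length_layout:
  "length (layout n vrec thr rows) = 8 * (n + length rows + 1) + sum_list (map length rows)"
  by (simp add: layout_def length_concat)

lemma layout_nth:
  assumes "q < n + length rows + 1" "r < 8"
  shows "8 * q + r < length (layout n vrec thr rows)"
    "layout n vrec thr rows ! (8 * q + r) = cell n vrec thr rows q r"
proof -
  have lt: "8 * q + r < 8 * (n + length rows + 1)" using assms by presburger
  then show "8 * q + r < length (layout n vrec thr rows)"
    by (simp add: length_layout)
  have "(8 * q + r) div 8 = q" "(8 * q + r) mod 8 = r" using assms(2) by simp_all
  then show "layout n vrec thr rows ! (8 * q + r) = cell n vrec thr rows q r"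
    unfolding layout_def using lt by (simp add: nth_append del: mult_Suc_right)
qed

lemma layout_row_nth:
  assumes "i < length rows" "j < length (rows ! i)"
  shows "row_pointer n rows i + j < length (layout n vrec thr rows)"
    "layout n vrec thr rows ! (row_pointer n rows i + j) = rows ! i ! j"
  using concat_nth_offset[OF assms] by (simp_all add: layout_def row_pointer_def nth_append add.assoc)

text \<open>The bound on the total length also covers \<open>n\<close>, the row lengths and the row
  pointers, none of which exceeds it.\<close>

lemma layout_bounded:
  assumes "length (layout n vrec thr rows) < B" "\<And>x r. x < n \<Longrightarrow> vrec x r < B" "\<And>i j. i < length rows \<Longrightarrow> thr i j < B"
    "\<And>xs x. xs \<in> set rows \<Longrightarrow> x \<in> set xs \<Longrightarrow> x < B"
  shows "\<forall>x\<in>set (layout n vrec thr rows). x < B"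
proof -
  have pre: "sum_list (map length (take i rows)) \<le> sum_list (map length rows)" for i
    by (subst (2) append_take_drop_id[of i rows, symmetric]) (simp only: map_append sum_list_append le_add1)
  have len: "length (rows ! i) \<le> sum_list (map length rows)" if "i < length rows" for i
    using that by (intro member_le_sum_list) auto
  have "cell n vrec thr rows q r < B" if q: "q < n + length rows + 1" for q r
  proof (cases "q \<le> n")
    case True
    then show ?thesis
      using assms(1,2) by (auto simp: length_layout cell_def)
  next
    case False
    then have "q - 1 - n < length rows" using q by linarith
    then show ?thesis
      using assms(1) assms(3)[of "q - 1 - n"] pre[of "q - 1 - n"] len[of "q - 1 - n"] False
      unfolding length_layout cell_def row_pointer_def by auto
  qed
  then have "cell n vrec thr rows (a div 8) (a mod 8) < B" if "a < 8 * (n + length rows + 1)" for a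
    using that by (simp add: less_mult_imp_div_less mult.commute)
  then show ?thesis
    using assms(4) by (auto simp: layout_def)
qed

section \<open>Class labels and assembly of the data structure\<close>

lemma class_labels:
  assumes "bij_betw idx V {..<n}"
  obtains lab :: "'a \<Rightarrow> nat" where "\<And>u. u \<in> V \<Longrightarrow> lab u < n"
    "\<And>u v. u \<in> V \<Longrightarrow> v \<in> V \<Longrightarrow> lab u = lab v \<longleftrightarrow> inseparable F u v"
proof -
  \<comment> \<open>Inseparable vertices satisfy the same predicate here, so the choice yields one
    common representative per class.\<close>
  define rep where "rep u = (SOME y. y \<in> V \<and> inseparable F u y)" for u
  have rep: "rep u \<in> V \<and> inseparable F u (rep u)" if "u \<in> V" for u
    unfolding rep_def by (rule someI[of _ u]) (simp add: that)
  show ?thesis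
  proof (rule that[of "\<lambda>u. idx (rep u)"])
    fix u assume "u \<in> V"
    then show "idx (rep u) < n" using rep assms by (auto simp: bij_betw_def)
  next
    fix u v assume uv: "u \<in> V" "v \<in> V"
    show "idx (rep u) = idx (rep v) \<longleftrightarrow> inseparable F u v"
    proof
      assume "idx (rep u) = idx (rep v)"
      then have "rep u = rep v" using assms rep uv by (auto simp: bij_betw_def dest: inj_onD)
      then show "inseparable F u v"
        using rep[OF uv(1)] rep[OF uv(2)] inseparable_sym inseparable_trans by metis
    next
      assume "inseparable F u v"
      then have "inseparable F u y \<longleftrightarrow> inseparable F v y" for y
        using inseparable_sym inseparable_trans by metis
      then show "idx (rep u) = idx (rep v)" by (simp add: rep_def)
    qed
  qed
qed

lemma (in steiner_multigraph) data_structure_exists: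
  assumes idx: "bij_betw idx V {..<n}" and w: "n ^ 8 \<le> 2 ^ w"
  shows "\<exists>D :: nat list.
    (\<forall>x\<in>set D. x < 2 ^ w) \<and> length D \<le> 20 * (n * (n - card S + 1)) \<and>
    (\<forall>u\<in>V. \<forall>v\<in>V.
       answers_query w decide_prog D (idx u) (idx v) 30
         (\<lambda>out. out = [of_bool (\<exists>C. least_separating_steiner_cut V E S u v C \<and> cap C = lam + 1)]) \<and>
       ((\<exists>C. steiner_cut V S C \<and> separates C u v \<and> cap C = lam + 1) \<longrightarrow>
        answers_query w report_prog D (idx u) (idx v) (200 * n)
          (\<lambda>out. \<exists>C. steiner_cut V S C \<and> separates C u v \<and> cap C = lam + 1 \<and>
             distinct out \<and> set out = idx ` C)))"
proof -
  have cardV: "card V = n" using bij_betw_same_card[OF idx] by simp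
  define k where "k = n - card S"
  have card_le: "card S \<le> n" using card_mono[OF finite_V S_subset] cardV by simp
  have cardN: "card (V - S) = k"
    using card_Diff_subset[OF _ S_subset] finite_subset[OF S_subset finite_V] cardV by (simp add: k_def)
  have n2: "2 \<le> n" using card_S card_le by simp
  obtain pos :: "'a \<Rightarrow> nat" and Cs1 Cs2 where pos: "\<forall>x\<in>S. pos x < card V"
    and Cs: "length Cs1 \<le> card S" "length Cs2 \<le> card (V - S)" "set Cs1 \<subseteq> cuts (lam + 1)" "set Cs2 \<subseteq> cuts (lam + 1)"
    and thr: "\<forall>C\<in>set Cs1. threshold_set pos C"
    and sep: "\<And>u v. u \<in> V \<Longrightarrow> v \<in> V \<Longrightarrow> (\<exists>C\<in>cuts (lam + 1). separates C u v) \<Longrightarrow> \<exists>C\<in>set (Cs1 @ Cs2). separates C u v"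
    by (rule report_family) blast
  obtain th :: "'a set \<Rightarrow> nat \<Rightarrow> nat" where th: "\<forall>C\<in>set Cs1. (\<forall>j. th C j \<le> card V) \<and>
      (\<forall>x\<in>S. x \<in> C \<longleftrightarrow> ((pos x < th C 0) = (pos x < th C 1)) \<noteq> ((pos x < th C 2) = (pos x < th C 3)))"
    using bchoice[OF thr[unfolded threshold_set_def]] by blast
  obtain lab0 :: "'a \<Rightarrow> nat" where lab0: "\<And>u. u \<in> V \<Longrightarrow> lab0 u < n"
    "\<And>u v. u \<in> V \<Longrightarrow> v \<in> V \<Longrightarrow> lab0 u = lab0 v \<longleftrightarrow> inseparable (cuts lam) u v"
    using class_labels[OF idx, of "cuts lam"] by blast
  obtain lab1 :: "'a \<Rightarrow> nat" where lab1: "\<And>u. u \<in> V \<Longrightarrow> lab1 u < n"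
    "\<And>u v. u \<in> V \<Longrightarrow> v \<in> V \<Longrightarrow> lab1 u = lab1 v \<longleftrightarrow> inseparable (cuts (lam + 1)) u v"
    using class_labels[OF idx, of "cuts (lam + 1)"] by blast
  \<comment> \<open>Columns list the nonterminals first, so a row cut off after \<open>k\<close>
    columns still covers all of them.\<close>
  obtain vs where vs: "\<And>x. x \<in> V \<Longrightarrow> \<exists>j<n. vs ! j = x \<and> (x \<notin> S \<longrightarrow> j < k)"
  proof -
    obtain xs where xs: "set xs = V - S" "distinct xs" using finite_distinct_list finite_V by blast
    obtain ys where ys: "set ys = S" "distinct ys"
      using finite_distinct_list finite_subset[OF S_subset finite_V] by blast
    have len: "length xs = k" "length ys = card S"
      using distinct_card[OF xs(2)] distinct_card[OF ys(2)] xs(1) ys(1) cardN by simp_all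
    have kn: "k + card S = n" using card_le by (simp add: k_def)
    show ?thesis
    proof (rule that[of "xs @ ys"])
      fix x assume x: "x \<in> V"
      show "\<exists>j<n. (xs @ ys) ! j = x \<and> (x \<notin> S \<longrightarrow> j < k)"
      proof (cases "x \<in> S")
        case True
        then obtain j where "j < length ys" "ys ! j = x" using ys(1) by (metis in_set_conv_nth)
        then show ?thesis using len kn True by (intro exI[of _ "k + j"]) (simp add: nth_append)
      next
        case False
        then obtain j where "j < length xs" "xs ! j = x" using xs(1) x by (metis in_set_conv_nth DiffI)
        then show ?thesis using len kn by (intro exI[of _ j]) (simp add: nth_append)
      qed
    qed
  qed
  obtain col where col: "\<And>x. x \<in> V \<Longrightarrow> col x < n" "\<And>x. x \<in> V \<Longrightarrow> vs ! col x = x"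
    "\<And>x. x \<in> V \<Longrightarrow> x \<notin> S \<Longrightarrow> col x < k"
    using vs by metis
  define Cs where "Cs = Cs1 @ Cs2"
  define M where "M = length Cs"
  have M: "M \<le> n" using Cs(1,2) cardN card_le by (simp add: M_def Cs_def k_def)
  define wid where "wid i = (if i < length Cs1 then k else n)" for i
  define rows :: "nat list list" where "rows = map (\<lambda>i. map (\<lambda>j. of_bool (vs ! j \<notin> Cs ! i)) [0..<wid i]) [0..<M]"
  define vx where "vx = inv_into V idx"
  have vx: "vx (idx x) = x" if "x \<in> V" for x
    using that idx unfolding vx_def by (auto simp: bij_betw_def)
  have vx_in: "vx a \<in> V \<and> idx (vx a) = a" if "a < n" for a
    using that idx unfolding vx_def by (metis bij_betw_def f_inv_into_f inv_into_into lessThan_iff)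
  define vrec where "vrec a r = (let x = vx a in if r = 0 then col x else if r = 1 then (if x \<in> S then pos x else 0)
      else if r = 2 then lab0 x else lab1 x)" for a and r :: nat
  define tr where "tr i j = (if i < length Cs1 then th (Cs ! i) j else 0)" for i j
  define D where "D = layout n vrec tr rows"
  have len_rows [simp]: "length rows = M" by (simp add: rows_def)
  have row_len: "length (rows ! i) = wid i" if "i < M" for i
    using that by (simp add: rows_def)
  have k_le: "k + 1 \<le> n" using card_S card_le by (simp add: k_def)
  have lenD: "length D \<le> 20 * (n * (k + 1))"
  proof -
    have "sum_list (map length rows) = length Cs1 * k + length Cs2 * n"
    proof -
      have "map length rows = map wid [0..<M]"
        by (simp add: rows_def comp_def)
      also have "[0..<M] = [0..<length Cs1] @ [length Cs1..<M]"
        by (metis M_def Cs_def length_append le_add1 upt_add_eq_append zero_le add_0)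
      also have "sum_list (map wid ([0..<length Cs1] @ [length Cs1..<M])) = length Cs1 * k + length Cs2 * n"
      proof -
        have "map wid [0..<length Cs1] = replicate (length Cs1) k"
          by (rule replicate_eqI) (auto simp: wid_def)
        moreover have "map wid [length Cs1..<M] = replicate (length Cs2) n"
          by (rule replicate_eqI) (auto simp: wid_def M_def Cs_def)
        ultimately show ?thesis by (simp only: map_append sum_list_append sum_list_replicate of_nat_id)
      qed
      finally show ?thesis .
    qed
    also have "\<dots> \<le> n * k + k * n"
      using Cs(1,2) cardN card_le by (intro add_le_mono mult_le_mono1) auto
    finally have "length D \<le> 8 * (n + M + 1) + 2 * (n * k)"
      by (simp add: D_def length_layout mult.commute)
    \<comment> \<open>\<open>M \<le> n\<close> and \<open>2 \<le> n\<close> give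
      \<open>8 * (n + M + 1) \<le> 20 * n\<close>.\<close>
    also have "\<dots> \<le> 20 * n + 20 * (n * k)" using M n2 by (intro add_le_mono) auto
    finally show ?thesis by (simp add: algebra_simps)
  qed
  \<comment> \<open>The word exponent 8 comes from here: six factors \<open>n\<close> supply the
    constant 64, two cover the quadratic space bound.\<close>
  have big: "64 * (n * n) \<le> 2 ^ w"
  proof -
    have "(2::nat) ^ 6 \<le> n ^ 6" using n2 by (rule power_mono) simp
    then have "64 * n ^ 2 \<le> n ^ 6 * n ^ 2" by (intro mult_le_mono1) simp
    also have "\<dots> = n ^ 8" by (simp flip: power_add)
    finally show ?thesis using w by (simp add: power2_eq_square)
  qed
  have nn: "2 * n \<le> n * n" using n2 by (rule mult_le_mono1)
  have "n * (k + 1) \<le> n * n" using k_le by (rule mult_le_mono2)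
  then have lenD_w: "length D < 2 ^ w" using lenD big nn n2 by linarith
  have n_w: "n < 2 ^ w" "8 * n + 8 * M + 16 < 2 ^ w" using big nn n2 M by linarith+
  have D_bound: "\<forall>x\<in>set D. x < 2 ^ w"
    unfolding D_def
  proof (rule layout_bounded)
    show "length (layout n vrec tr rows) < 2 ^ w" using lenD_w by (simp add: D_def)
    show "vrec a r < 2 ^ w" if "a < n" for a r
      using vx_in[OF that] col(1) lab0(1) lab1(1) pos cardV n_w(1)
      unfolding vrec_def Let_def by (auto intro: less_trans)
    show "tr i j < 2 ^ w" if "i < length rows" for i j
    proof (cases "i < length Cs1")
      case True
      then have "Cs ! i \<in> set Cs1" by (simp add: Cs_def nth_append)
      then have "tr i j \<le> n" using th cardV True by (simp add: tr_def)
      then show ?thesis using n_w by simp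
    qed (simp add: tr_def)
    show "x < 2 ^ w" if "xs \<in> set rows" "x \<in> set xs" for xs x
      using that n_w n2 by (auto simp: rows_def)
  qed
  \<comment> \<open>Stated for every memory that agrees with \<open>D\<close> on its cells, since a
    query starts with arbitrary contents elsewhere.\<close>
  have decode: "m 0 = n" "\<And>x. x \<in> V \<Longrightarrow> m (8 * idx x + 10) = lab0 x" "\<And>x. x \<in> V \<Longrightarrow> m (8 * idx x + 11) = lab1 x"
    "\<And>x. x \<in> V \<Longrightarrow> m (8 * idx x + 8) = col x" "\<And>i. i < M \<Longrightarrow> m (cut_record n i) = wid i"
    "\<And>x i. x \<in> V \<Longrightarrow> i < M \<Longrightarrow> col x < wid i \<Longrightarrow> m (cut_record n i + 1) + col x < length D"
    "\<And>x i. x \<in> V \<Longrightarrow> i < M \<Longrightarrow> outside_flag m (idx x) (cut_record n i) = of_bool (x \<notin> Cs ! i)"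
    if m: "\<forall>a<length D. m a = D ! a" for m
  proof -
    have cell: "m (8 * q + r) = cell n vrec tr rows q r" if "q < n + M + 1" "r < 8" for q r
      using layout_nth[of q n rows r vrec tr] that m by (simp add: D_def)
    show m0: "m 0 = n" using cell[of 0 0] by (simp add: cell_def)
    have vertex: "m (8 * idx x + 8 + r) = vrec (idx x) r" if "x \<in> V" "r < 8" for x r
    proof -
      have "idx x < n" using that(1) idx by (auto simp: bij_betw_def)
      then show ?thesis using cell[of "idx x + 1" r] that(2) by (simp add: cell_def algebra_simps)
    qed
    have rec: "m (cut_record n i + r) = cell n vrec tr rows (n + i + 1) r" if "i < M" "r < 8" for i r
      using cell[of "n + i + 1" r] that by (simp add: cut_record_def algebra_simps)
    show "m (8 * idx x + 10) = lab0 x" if "x \<in> V" for x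
      using vertex[OF that, of 2] vx[OF that] by (simp add: vrec_def add.commute)
    show "m (8 * idx x + 11) = lab1 x" if "x \<in> V" for x
      using vertex[OF that, of 3] vx[OF that] by (simp add: vrec_def add.commute)
    show m_col: "m (8 * idx x + 8) = col x" if "x \<in> V" for x
      using vertex[OF that, of 0] vx[OF that] by (simp add: vrec_def)
    have m_pos: "m (8 * idx x + 9) = pos x" if "x \<in> V" "x \<in> S" for x
      using vertex[OF that(1), of 1] vx[OF that(1)] that(2) by (simp add: vrec_def add.commute)
    show m_wid: "m (cut_record n i) = wid i" if "i < M" for i
      using rec[OF that, of 0] row_len[OF that] by (simp add: cell_def)
    have m_ptr: "m (cut_record n i + 1) = row_pointer n rows i" if "i < M" for i
      using rec[OF that, of 1] by (simp add: cell_def)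
    have m_tr: "m (cut_record n i + 2) = tr i 0" "m (cut_record n i + 3) = tr i 1"
      "m (cut_record n i + 4) = tr i 2" "m (cut_record n i + 5) = tr i 3" if "i < M" for i
      using rec[OF that, of 2] rec[OF that, of 3] rec[OF that, of 4] rec[OF that, of 5]
      by (simp_all add: cell_def)
    have row: "row_pointer n rows i + col x < length D"
      "m (row_pointer n rows i + col x) = of_bool (x \<notin> Cs ! i)"
      if "x \<in> V" "i < M" "col x < wid i" for x i
    proof -
      note r = layout_row_nth[of i rows "col x" n vrec tr, folded D_def, unfolded len_rows, OF that(2)]
      have "col x < length (rows ! i)" using that row_len by simp
      note r = r[OF this]
      show "row_pointer n rows i + col x < length D" by (rule r(1))
      then have "m (row_pointer n rows i + col x) = rows ! i ! col x" using m r(2) by simp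
      also have "\<dots> = of_bool (x \<notin> Cs ! i)"
        using that col(2) by (simp add: rows_def)
      finally show "m (row_pointer n rows i + col x) = of_bool (x \<notin> Cs ! i)" .
    qed
    show "m (cut_record n i + 1) + col x < length D" if "x \<in> V" "i < M" "col x < wid i" for x i
      unfolding m_ptr[OF that(2)] by (rule row(1)[OF that])
    show "outside_flag m (idx x) (cut_record n i) = of_bool (x \<notin> Cs ! i)" if "x \<in> V" "i < M" for x i
    proof (cases "col x < wid i")
      case True
      then show ?thesis
        unfolding outside_flag_def m_col[OF that(1)] m_wid[OF that(2)] m_ptr[OF that(2)]
        using row(2)[OF that] by simp
    next
      case False
      \<comment> \<open>Full rows have \<open>n\<close> columns, so a missing column means a
        threshold cut, and the missing vertex is a terminal.\<close>
      then have i1: "i < length Cs1" using col(1)[OF that(1)] by (auto simp: wid_def split: if_splits)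
      then have xS: "x \<in> S" using False col(3)[OF that(1)] by (auto simp: wid_def)
      have Ci: "Cs ! i \<in> set Cs1" using i1 by (simp add: Cs_def nth_append)
      have "x \<in> Cs ! i \<longleftrightarrow> ((pos x < tr i 0) = (pos x < tr i 1)) \<noteq> ((pos x < tr i 2) = (pos x < tr i 3))"
        using th Ci xS i1 by (simp add: tr_def)
      then have "of_bool (x \<notin> Cs ! i) =
          (of_bool (((pos x < tr i 0) = (pos x < tr i 1)) = ((pos x < tr i 2) = (pos x < tr i 3))) :: nat)"
        by simp
      then show ?thesis
        unfolding outside_flag_def m_col[OF that(1)] m_wid[OF that(2)] m_pos[OF that(1) xS] m_tr[OF that(2)]
        using False by simp
    qed
  qed
  have idx_lt: "idx x < n" if "x \<in> V" for x using that idx by (auto simp: bij_betw_def)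
  have "answers_query w decide_prog D (idx u) (idx v) 30
      (\<lambda>out. out = [of_bool (\<exists>C. least_separating_steiner_cut V E S u v C \<and> cap C = lam + 1)])"
    if uv: "u \<in> V" "v \<in> V" for u v
    unfolding answers_query_def
  proof (intro allI impI)
    fix s assume "query_state w D (idx u) (idx v) s"
    then have s: "regs s 0 = idx u" "regs s 1 = idx v" "emitted s = []" "\<forall>a<length D. mem s a = D ! a"
      by (auto simp: query_state_def)
    have "8 * idx u + 16 < 2 ^ w" "8 * idx v + 16 < 2 ^ w"
      using idx_lt[OF uv(1)] idx_lt[OF uv(2)] n_w(2) by linarith+
    from exec_decide_prog[OF s(1,2) this s(3)]
    obtain t s' where t: "exec w decide_prog s t s'" "t \<le> 30" "mem s' = mem s"
      "emitted s' = [of_bool (lab0 u = lab0 v \<and> lab1 u \<noteq> lab1 v)]"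
      unfolding decode(2)[OF s(4) uv(1)] decode(2)[OF s(4) uv(2)] decode(3)[OF s(4) uv(1)] decode(3)[OF s(4) uv(2)]
      by blast
    have eq: "(\<exists>C. least_separating_steiner_cut V E S u v C \<and> cap C = lam + 1) \<longleftrightarrow> lab0 u = lab0 v \<and> lab1 u \<noteq> lab1 v"
      unfolding least_separating_iff using lab0(2)[OF uv] lab1(2)[OF uv] by blast
    show "\<exists>t s'. exec w decide_prog s t s' \<and> t \<le> 30 \<and>
        emitted s' = [of_bool (\<exists>C. least_separating_steiner_cut V E S u v C \<and> cap C = lam + 1)] \<and>
        (\<forall>i<length D. mem s' i = D ! i)"
      unfolding eq using t s(4) by (intro exI[of _ t] exI[of _ s']) simp
  qed
  moreover have "answers_query w report_prog D (idx u) (idx v) (200 * n)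
      (\<lambda>out. \<exists>C. steiner_cut V S C \<and> separates C u v \<and> cap C = lam + 1 \<and> distinct out \<and> set out = idx ` C)"
    if uv: "u \<in> V" "v \<in> V" and ex: "\<exists>C. steiner_cut V S C \<and> separates C u v \<and> cap C = lam + 1" for u v
    unfolding answers_query_def
  proof (intro allI impI)
    fix s assume "query_state w D (idx u) (idx v) s"
    then have s: "regs s 0 = idx u" "regs s 1 = idx v" "emitted s = []" "\<forall>a<length D. mem s a = D ! a"
      by (auto simp: query_state_def)
    note dec = decode[OF s(4)]
    have wf: "well_formed w n M (mem s)"
      unfolding well_formed_def
    proof (intro conjI allI impI)
      fix a i assume ai: "a < n" "i < M" "mem s (8 * a + 8) < mem s (cut_record n i)"
      obtain x where x: "x \<in> V" "a = idx x" using vx_in[OF ai(1)] by metis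
      show "mem s (cut_record n i + 1) + mem s (8 * a + 8) < 2 ^ w"
        using dec(6)[OF x(1) ai(2)] ai(3) lenD_w unfolding x(2) dec(4)[OF x(1)] dec(5)[OF ai(2)]
        by linarith
    qed (use dec(1) n_w in auto)
    have "\<exists>C\<in>set Cs. separates C u v"
      using sep[OF uv] ex unfolding Cs_def cuts_def by blast
    then obtain i0 where i0: "i0 < M" "separates (Cs ! i0) u v"
      unfolding M_def by (metis in_set_conv_nth)
    have flags: "outside_flag (mem s) (regs s 0) (cut_record n i) \<noteq> outside_flag (mem s) (regs s 1) (cut_record n i)
        \<longleftrightarrow> separates (Cs ! i) u v" if "i < M" for i
      unfolding s(1,2) dec(7)[OF uv(1) that] dec(7)[OF uv(2) that] by (auto simp: separates_def)
    have lt: "regs s 0 < n" "regs s 1 < n" using s idx_lt uv by simp_all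
    obtain t s' i where t: "exec w report_prog s t s'" "t \<le> 200 * n" "mem s' = mem s" and i: "i < M"
      "outside_flag (mem s) (regs s 0) (cut_record n i) \<noteq> outside_flag (mem s) (regs s 1) (cut_record n i)"
      and out: "emitted s' = filter (\<lambda>x. outside_flag (mem s) x (cut_record n i) = 0) [0..<n]"
      using exec_report_prog[OF wf lt M s(3)] flags i0 by blast
    have "Cs ! i \<in> set Cs" using i(1) by (simp add: M_def)
    then have Ci: "Cs ! i \<in> cuts (lam + 1)" using Cs(3,4) by (auto simp: Cs_def)
    have "set (emitted s') = {a. a < n \<and> outside_flag (mem s) a (cut_record n i) = 0}"
      by (auto simp: out)
    also have "\<dots> = idx ` (Cs ! i)"
    proof (intro set_eqI iffI)
      fix a assume "a \<in> {a. a < n \<and> outside_flag (mem s) a (cut_record n i) = 0}"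
      then have a: "a < n" "outside_flag (mem s) a (cut_record n i) = 0" by auto
      then show "a \<in> idx ` (Cs ! i)"
        using vx_in[OF a(1)] dec(7)[of "vx a" i] i(1) by (auto intro: image_eqI[of _ _ "vx a"])
    next
      fix a assume "a \<in> idx ` (Cs ! i)"
      then obtain x where x: "x \<in> Cs ! i" "a = idx x" by blast
      then have "x \<in> V" using cuts_subset[OF Ci] by blast
      then show "a \<in> {a. a < n \<and> outside_flag (mem s) a (cut_record n i) = 0}"
        using x dec(7)[of x i] i(1) idx_lt by simp
    qed
    finally have set_out: "set (emitted s') = idx ` (Cs ! i)" .
    have "steiner_cut V S (Cs ! i)" "cap (Cs ! i) = lam + 1" using Ci by (simp_all add: cuts_def)
    moreover have "separates (Cs ! i) u v" using flags[OF i(1)] i(2) by blast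
    moreover have "distinct (emitted s')" by (simp add: out)
    ultimately show "\<exists>t s'. exec w report_prog s t s' \<and> t \<le> 200 * n \<and>
        (\<exists>C. steiner_cut V S C \<and> separates C u v \<and> cap C = lam + 1 \<and>
           distinct (emitted s') \<and> set (emitted s') = idx ` C) \<and> (\<forall>i<length D. mem s' i = D ! i)"
      using t s(4) set_out by (intro exI[of _ t] exI[of _ s'] conjI exI[of _ "Cs ! i"]) simp_all
  qed
  ultimately show ?thesis
    using D_bound lenD unfolding k_def by blast
qed

text \<open>Programs and constants are chosen before the graph and the word size, so the bounds are
  uniform. \<open>n ^ c_word \<le> 2 ^ w\<close> expresses words of logarithmic length, and
  \<open>idx\<close> numbers the vertices for the machine.\<close>

theorem theorem3:
  "\<exists>(decide :: prog) (report :: prog) (c_word :: nat) (c_space :: nat) (c_decide :: nat) (c_report :: nat).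
     \<forall>(V :: 'a set) (E :: 'a set multiset) (S :: 'a set) (idx :: 'a \<Rightarrow> nat) (n :: nat) (w :: nat).
       connected_multigraph V E \<and> card V = n \<and> S \<subseteq> V \<and> card S \<ge> 2 \<and>
       bij_betw idx V {..<n} \<and> n ^ c_word \<le> 2 ^ w \<longrightarrow>
       (\<exists>D :: nat list.
          (\<forall>x\<in>set D. x < 2 ^ w) \<and>
          length D \<le> c_space * (n * (n - card S + 1)) \<and>
          (\<forall>u\<in>V. \<forall>v\<in>V.
             answers_query w decide D (idx u) (idx v) c_decide
               (\<lambda>out. out = [of_bool (\<exists>C. least_separating_steiner_cut V E S u v C \<and>
                                          capacity V E C = mincut_capacity V E S + 1)]) \<and>
             ((\<exists>C. steiner_cut V S C \<and> separates C u v \<and>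
                   capacity V E C = mincut_capacity V E S + 1) \<longrightarrow>
              answers_query w report D (idx u) (idx v) (c_report * n)
                (\<lambda>out. \<exists>C. steiner_cut V S C \<and> separates C u v \<and>
                           capacity V E C = mincut_capacity V E S + 1 \<and>
                           distinct out \<and> set out = idx ` C))))"
proof (rule exI[of _ decide_prog], rule exI[of _ report_prog], rule exI[of _ 8], rule exI[of _ 20],
    rule exI[of _ 30], rule exI[of _ 200], intro allI impI, elim conjE)
  fix V :: "'a set" and E S and idx :: "'a \<Rightarrow> nat" and n w :: nat
  assume "connected_multigraph V E" "S \<subseteq> V" "2 \<le> card S"
    and idx: "bij_betw idx V {..<n}" "n ^ 8 \<le> 2 ^ w"
  then interpret steiner_multigraph V E S
    by unfold_locales (simp_all add: connected_multigraph_def)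
  show "\<exists>D :: nat list.
          (\<forall>x\<in>set D. x < 2 ^ w) \<and>
          length D \<le> 20 * (n * (n - card S + 1)) \<and>
          (\<forall>u\<in>V. \<forall>v\<in>V.
             answers_query w decide_prog D (idx u) (idx v) 30
               (\<lambda>out. out = [of_bool (\<exists>C. least_separating_steiner_cut V E S u v C \<and>
                                          capacity V E C = mincut_capacity V E S + 1)]) \<and>
             ((\<exists>C. steiner_cut V S C \<and> separates C u v \<and>
                   capacity V E C = mincut_capacity V E S + 1) \<longrightarrow>
              answers_query w report_prog D (idx u) (idx v) (200 * n)
                (\<lambda>out. \<exists>C. steiner_cut V S C \<and> separates C u v \<and>
                           capacity V E C = mincut_capacity V E S + 1 \<and>
                           distinct out \<and> set out = idx ` C)))"
    using data_structure_exists[OF idx] .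
qed

end
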